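(* Let $\mathfrak{g}_T$ and $\mathfrak{h}_S$ be two Rota-Baxter Lie algebras. Then the set of equivalence classes of non-abelian extensions of $\mathfrak{g}_T$ by $\mathfrak{h}_S$ is classified by $H^2_{nab}(\mathfrak{g}_T,\mathfrak{h}_S)$: the map $\Upsilon:\mathrm{Ext}_{nab}(\mathfrak{g}_T,\mathfrak{h}_S)\to H^2_{nab}(\mathfrak{g}_T,\mathfrak{h}_S)$, sending the class of an extension to the class of the non-abelian $2$-cocycle associated with it (via any section), is a bijection. In other words, $\mathrm{Ext}_{nab}(\mathfrak{g}_T,\mathfrak{h}_S)\cong H^2_{nab}(\mathfrak{g}_T,\mathfrak{h}_S)$.
   Context: All vector spaces, linear maps and Lie algebras are over a field $\mathbf{k}$ of characteristic $0$. A Rota-Baxter Lie algebra $\mathfrak{g}_T$ is a Lie algebra $\mathfrak{g}$ with a linear map $T:\mathfrak{g}\to\mathfrak{g}$ (a Rota-Baxter operator) satisfying $[T(x),T(y)]_\mathfrak{g}=T([T(x),y]_\mathfrak{g}+[x,T(y)]_\mathfrak{g})$ for all $x,y\in\mathfrak{g}$. A morphism $\mathfrak{g}_T\to\mathfrak{g}'_{T'}$ is a Lie algebra homomorphism $\varphi$ with $T'\circ\varphi=\varphi\circ T$. A non-abelian extension of $\mathfrak{g}_T$ by $\mathfrak{h}_S$ is a Rota-Baxter Lie algebra $\mathfrak{e}_U$ with a short exact sequence $0\to\mathfrak{h}_S\xrightarrow{i}\mathfrak{e}_U\xrightarrow{p}\mathfrak{g}_T\to0$ of morphisms of Rota-Baxter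 Lie algebras; $\mathfrak{h}$ is identified with $i(\mathfrak{h})$. Two extensions $\mathfrak{e}_U$ (with maps $i,p$) and $\mathfrak{e}'_{U'}$ (with maps $i',p'$) are equivalent if there is a morphism $\varphi:\mathfrak{e}_U\to\mathfrak{e}'_{U'}$ of Rota-Baxter Lie algebras with $\varphi\circ i=i'$ and $p'\circ\varphi=p$. $\mathrm{Ext}_{nab}(\mathfrak{g}_T,\mathfrak{h}_S)$ is the set of equivalence classes. A non-abelian $2$-cocycle of $\mathfrak{g}_T$ with values in $\mathfrak{h}_S$ is a triple $(\chi,\psi,\Phi)$ of linear maps $\chi:\wedge^2\mathfrak{g}\to\mathfrak{h}$, $\psi:\mathfrak{g}\to\mathrm{Der}(\mathfrak{h})$, $\Phi:\mathfrak{g}\to\mathfrak{h}$ such that for all $x,y,z\in\mathfrak{g}$, $h\in\mathfrak{h}$: (i) $\psi_x\psi_y(h)-\psi_y\psi_x(h)-\psi_{[x,y]_\mathfrak{g}}(h)=[\chi(x,y),h]_\mathfrak{h}$; (ii) $\psi_x\chi(y,z)+\psi_y\chi(z,x)+\psi_z\chi(x,y)-\chi([x,y]_\mathfrak{g},z)-\chi([y,z]_\mathfrak{g},x)-\chi([z,x]_\mathfrak{g},y)=0$; (iii) $\psi_{T(x)}S(h)=S(\psi_xS(h)+\psi_{T(x)}h)+S[\Phi(x),h]_\mathfrak{h}-[\Phi(x),S(h)]_\mathfrak{h}$; (iv) $\chi(T(x),T(y))-S(\chi(x,T(y))+\chi(T(x),y))-\Phi([x,T(y)]_\mathfrak{g}+[T(x),y]_\mathfrak{g})+\psi_{T(x)}\Phi(y)-\psi_{T(y)}\Phi(x)-S(\psi_x\Phi(y)-\psi_y\Phi(x))+[\Phi(x),\Phi(y)]_\mathfrak{h}=0$.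 Here $\mathrm{Der}(\mathfrak{h})$ is the space of Lie algebra derivations of $\mathfrak{h}$. Two non-abelian $2$-cocycles $(\chi,\psi,\Phi)$, $(\chi',\psi',\Phi')$ are equivalent if there is a linear map $\varphi:\mathfrak{g}\to\mathfrak{h}$ such that for all $x,y\in\mathfrak{g}$, $h\in\mathfrak{h}$: $\psi_x(h)-\psi'_x(h)=[\varphi(x),h]_\mathfrak{h}$; $\chi(x,y)-\chi'(x,y)=\psi'_x(\varphi(y))-\psi'_y(\varphi(x))-\varphi([x,y]_\mathfrak{g})+[\varphi(x),\varphi(y)]_\mathfrak{h}$; $\Phi(x)-\Phi'(x)=S(\varphi(x))-\varphi(T(x))$. $H^2_{nab}(\mathfrak{g}_T,\mathfrak{h}_S)$ is the set of equivalence classes of non-abelian $2$-cocycles. Given an extension $\mathfrak{e}_U$ and a section $s$ of $p$ (a linear map $s:\mathfrak{g}\to\mathfrak{e}$ with $p\circ s=\mathrm{id}_\mathfrak{g}$), the associated triple is $\chi(x,y)=[s(x),s(y)]_\mathfrak{e}-s[x,y]_\mathfrak{g}$, $\psi_x(h)=[s(x),h]_\mathfrak{e}$, $\Phi(x)=U(s(x))-s(T(x))$; it is a non-abelian $2$-cocycle whose class does not depend on $s$. *)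

theory Defs
  imports "HOL-Algebra.Module" "HOL-Algebra.AbelCoset"
begin

text \<open>
  All structures are HOL-Algebra style records with an explicit carrier. The record \<open>module\<close>
  inherits the fields \<open>mult\<close> and \<open>one\<close> from \<open>ring\<close>; they are unconstrained and play no role
  here, and likewise every map is only ever inspected on the relevant carriers.
\<close>

definition char_zero :: "('k, 'm) ring_scheme \<Rightarrow> bool" where
  "char_zero K \<longleftrightarrow> (\<forall>n::nat. n > 0 \<longrightarrow> [n] \<cdot>\<^bsub>K\<^esub> \<one>\<^bsub>K\<^esub> \<noteq> \<zero>\<^bsub>K\<^esub>)"

record ('k, 'a) lie_alg = "('k, 'a) module" +
  bracket :: "'a \<Rightarrow> 'a \<Rightarrow> 'a" (\<open>\<lbrakk>_, _\<rbrakk>\<index>\<close>)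

record ('k, 'a) rb_lie_alg = "('k, 'a) lie_alg" +
  rbop :: "'a \<Rightarrow> 'a"

locale lie_algebra = field K + module K L for K (structure) and L (structure) +
  assumes bracket_closed:
      "\<lbrakk>x \<in> carrier L; y \<in> carrier L\<rbrakk> \<Longrightarrow> \<lbrakk>x, y\<rbrakk>\<^bsub>L\<^esub> \<in> carrier L"
    and bracket_add_left:
      "\<lbrakk>x \<in> carrier L; y \<in> carrier L; z \<in> carrier L\<rbrakk>
        \<Longrightarrow> \<lbrakk>x \<oplus>\<^bsub>L\<^esub> y, z\<rbrakk>\<^bsub>L\<^esub> = \<lbrakk>x, z\<rbrakk>\<^bsub>L\<^esub> \<oplus>\<^bsub>L\<^esub> \<lbrakk>y, z\<rbrakk>\<^bsub>L\<^esub>"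
    and bracket_add_right:
      "\<lbrakk>x \<in> carrier L; y \<in> carrier L; z \<in> carrier L\<rbrakk>
        \<Longrightarrow> \<lbrakk>x, y \<oplus>\<^bsub>L\<^esub> z\<rbrakk>\<^bsub>L\<^esub> = \<lbrakk>x, y\<rbrakk>\<^bsub>L\<^esub> \<oplus>\<^bsub>L\<^esub> \<lbrakk>x, z\<rbrakk>\<^bsub>L\<^esub>"
    and bracket_smult_left:
      "\<lbrakk>a \<in> carrier K; x \<in> carrier L; y \<in> carrier L\<rbrakk>
        \<Longrightarrow> \<lbrakk>a \<odot>\<^bsub>L\<^esub> x, y\<rbrakk>\<^bsub>L\<^esub> = a \<odot>\<^bsub>L\<^esub> \<lbrakk>x, y\<rbrakk>\<^bsub>L\<^esub>"
    and bracket_smult_right: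
      "\<lbrakk>a \<in> carrier K; x \<in> carrier L; y \<in> carrier L\<rbrakk>
        \<Longrightarrow> \<lbrakk>x, a \<odot>\<^bsub>L\<^esub> y\<rbrakk>\<^bsub>L\<^esub> = a \<odot>\<^bsub>L\<^esub> \<lbrakk>x, y\<rbrakk>\<^bsub>L\<^esub>"
    and bracket_self:
      "x \<in> carrier L \<Longrightarrow> \<lbrakk>x, x\<rbrakk>\<^bsub>L\<^esub> = \<zero>\<^bsub>L\<^esub>"
    and jacobi:
      "\<lbrakk>x \<in> carrier L; y \<in> carrier L; z \<in> carrier L\<rbrakk>
        \<Longrightarrow> \<lbrakk>x, \<lbrakk>y, z\<rbrakk>\<^bsub>L\<^esub>\<rbrakk>\<^bsub>L\<^esub> \<oplus>\<^bsub>L\<^esub> \<lbrakk>y, \<lbrakk>z, x\<rbrakk>\<^bsub>L\<^esub>\<rbrakk>\<^bsub>L\<^esub> \<oplus>\<^bsub>L\<^esub> \<lbrakk>z, \<lbrakk>x, y\<rbrakk>\<^bsub>L\<^esub>\<rbrakk>\<^bsub>L\<^esub> = \<zero>\<^bsub>L\<^esub>"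

definition linear_map ::
  "('k, 'm) ring_scheme \<Rightarrow> ('k, 'a, 'n) module_scheme \<Rightarrow> ('k, 'b, 'p) module_scheme
    \<Rightarrow> ('a \<Rightarrow> 'b) \<Rightarrow> bool" where
  "linear_map K V W f \<longleftrightarrow>
     f \<in> carrier V \<rightarrow> carrier W \<and>
     (\<forall>x\<in>carrier V. \<forall>y\<in>carrier V. f (x \<oplus>\<^bsub>V\<^esub> y) = f x \<oplus>\<^bsub>W\<^esub> f y) \<and>
     (\<forall>a\<in>carrier K. \<forall>x\<in>carrier V. f (a \<odot>\<^bsub>V\<^esub> x) = a \<odot>\<^bsub>W\<^esub> f x)"

locale rb_lie_algebra = lie_algebra K L for K (structure) and L (structure) +
  assumes rbop_linear: "linear_map K L L (rbop L)"
    and rota_baxter: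
      "\<lbrakk>x \<in> carrier L; y \<in> carrier L\<rbrakk>
        \<Longrightarrow> \<lbrakk>rbop L x, rbop L y\<rbrakk>\<^bsub>L\<^esub> = rbop L (\<lbrakk>rbop L x, y\<rbrakk>\<^bsub>L\<^esub> \<oplus>\<^bsub>L\<^esub> \<lbrakk>x, rbop L y\<rbrakk>\<^bsub>L\<^esub>)"

definition rb_lie_hom ::
  "('k, 'm) ring_scheme \<Rightarrow> ('k, 'a) rb_lie_alg \<Rightarrow> ('k, 'b) rb_lie_alg \<Rightarrow> ('a \<Rightarrow> 'b) \<Rightarrow> bool" where
  "rb_lie_hom K L M f \<longleftrightarrow>
     linear_map K L M f \<and>
     (\<forall>x\<in>carrier L. \<forall>y\<in>carrier L. f \<lbrakk>x, y\<rbrakk>\<^bsub>L\<^esub> = \<lbrakk>f x, f y\<rbrakk>\<^bsub>M\<^esub>) \<and>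
     (\<forall>x\<in>carrier L. rbop M (f x) = f (rbop L x))"

definition derivation ::
  "('k, 'm) ring_scheme \<Rightarrow> ('k, 'a, 'n) lie_alg_scheme \<Rightarrow> ('a \<Rightarrow> 'a) \<Rightarrow> bool" where
  "derivation K L d \<longleftrightarrow>
     linear_map K L L d \<and>
     (\<forall>x\<in>carrier L. \<forall>y\<in>carrier L. d \<lbrakk>x, y\<rbrakk>\<^bsub>L\<^esub> = \<lbrakk>d x, y\<rbrakk>\<^bsub>L\<^esub> \<oplus>\<^bsub>L\<^esub> \<lbrakk>x, d y\<rbrakk>\<^bsub>L\<^esub>)"


section \<open>Non-abelian extensions\<close>

text \<open>
  An extension of \<open>G\<close> by \<open>H\<close> is a triple \<open>(E, i, p)\<close>. Its total space \<open>E\<close> has its carrier in a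
  type \<open>'e\<close>, which serves as the universe from which the extensions are drawn.
\<close>

type_synonym ('k, 'g, 'h, 'e) rb_ext = "('k, 'e) rb_lie_alg \<times> ('h \<Rightarrow> 'e) \<times> ('e \<Rightarrow> 'g)"

definition nab_extensions ::
  "('k, 'm) ring_scheme \<Rightarrow> ('k, 'g) rb_lie_alg \<Rightarrow> ('k, 'h) rb_lie_alg
    \<Rightarrow> ('k, 'g, 'h, 'e) rb_ext set" where
  "nab_extensions K G H =
     {(E, i, p). rb_lie_algebra K E \<and> rb_lie_hom K H E i \<and> rb_lie_hom K E G p \<and>
        inj_on i (carrier H) \<and>
        i ` carrier H = a_kernel E G p \<and>
        p ` carrier E = carrier G}"

definition nab_ext_equiv ::
  "('k, 'm) ring_scheme \<Rightarrow> ('k, 'g) rb_lie_alg \<Rightarrow> ('k, 'h) rb_lie_alg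
    \<Rightarrow> ('k, 'g, 'h, 'e) rb_ext rel" where
  "nab_ext_equiv K G H =
     {((E, i, p), (E', i', p')).
        (E, i, p) \<in> nab_extensions K G H \<and> (E', i', p') \<in> nab_extensions K G H \<and>
        (\<exists>\<phi>. rb_lie_hom K E E' \<phi> \<and>
             (\<forall>h\<in>carrier H. \<phi> (i h) = i' h) \<and>
             (\<forall>e\<in>carrier E. p' (\<phi> e) = p e))}"

definition Ext_nab ::
  "('k, 'm) ring_scheme \<Rightarrow> ('k, 'g) rb_lie_alg \<Rightarrow> ('k, 'h) rb_lie_alg
    \<Rightarrow> ('k, 'g, 'h, 'e) rb_ext set set" where
  "Ext_nab K G H = nab_extensions K G H // nab_ext_equiv K G H"


section \<open>Non-abelian 2-cocycles\<close>

type_synonym ('g, 'h) nab_triple = "('g \<Rightarrow> 'g \<Rightarrow> 'h) \<times> ('g \<Rightarrow> 'h \<Rightarrow> 'h) \<times> ('g \<Rightarrow> 'h)"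

text \<open>A linear map out of the exterior square is given as an alternating bilinear map.\<close>

definition alternating_bilinear ::
  "('k, 'm) ring_scheme \<Rightarrow> ('k, 'a, 'n) module_scheme \<Rightarrow> ('k, 'b, 'p) module_scheme
    \<Rightarrow> ('a \<Rightarrow> 'a \<Rightarrow> 'b) \<Rightarrow> bool" where
  "alternating_bilinear K V W f \<longleftrightarrow>
     (\<forall>x\<in>carrier V. linear_map K V W (f x)) \<and>
     (\<forall>y\<in>carrier V. linear_map K V W (\<lambda>x. f x y)) \<and>
     (\<forall>x\<in>carrier V. f x x = \<zero>\<^bsub>W\<^esub>)"

text \<open>
  Linearity of \<open>\<psi>\<close> as a map into the space of derivations is expressed pointwise in \<open>h\<close>.
\<close>

definition nab_cocycles ::
  "('k, 'm) ring_scheme \<Rightarrow> ('k, 'g) rb_lie_alg \<Rightarrow> ('k, 'h) rb_lie_alg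
    \<Rightarrow> ('g, 'h) nab_triple set" where
  "nab_cocycles K G H =
     {(\<chi>, \<psi>, \<Phi>).
        alternating_bilinear K G H \<chi> \<and>
        (\<forall>x\<in>carrier G. derivation K H (\<psi> x)) \<and>
        (\<forall>h\<in>carrier H. linear_map K G H (\<lambda>x. \<psi> x h)) \<and>
        linear_map K G H \<Phi> \<and>
        (\<forall>x\<in>carrier G. \<forall>y\<in>carrier G. \<forall>h\<in>carrier H.
           \<psi> x (\<psi> y h) \<ominus>\<^bsub>H\<^esub> \<psi> y (\<psi> x h) \<ominus>\<^bsub>H\<^esub> \<psi> \<lbrakk>x, y\<rbrakk>\<^bsub>G\<^esub> h = \<lbrakk>\<chi> x y, h\<rbrakk>\<^bsub>H\<^esub>) \<and>
        (\<forall>x\<in>carrier G. \<forall>y\<in>carrier G. \<forall>z\<in>carrier G.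
           \<psi> x (\<chi> y z) \<oplus>\<^bsub>H\<^esub> \<psi> y (\<chi> z x) \<oplus>\<^bsub>H\<^esub> \<psi> z (\<chi> x y)
             \<ominus>\<^bsub>H\<^esub> \<chi> \<lbrakk>x, y\<rbrakk>\<^bsub>G\<^esub> z \<ominus>\<^bsub>H\<^esub> \<chi> \<lbrakk>y, z\<rbrakk>\<^bsub>G\<^esub> x \<ominus>\<^bsub>H\<^esub> \<chi> \<lbrakk>z, x\<rbrakk>\<^bsub>G\<^esub> y = \<zero>\<^bsub>H\<^esub>) \<and>
        (\<forall>x\<in>carrier G. \<forall>h\<in>carrier H.
           \<psi> (rbop G x) (rbop H h) =
             rbop H (\<psi> x (rbop H h) \<oplus>\<^bsub>H\<^esub> \<psi> (rbop G x) h)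
             \<oplus>\<^bsub>H\<^esub> rbop H \<lbrakk>\<Phi> x, h\<rbrakk>\<^bsub>H\<^esub> \<ominus>\<^bsub>H\<^esub> \<lbrakk>\<Phi> x, rbop H h\<rbrakk>\<^bsub>H\<^esub>) \<and>
        (\<forall>x\<in>carrier G. \<forall>y\<in>carrier G.
           \<chi> (rbop G x) (rbop G y)
             \<ominus>\<^bsub>H\<^esub> rbop H (\<chi> x (rbop G y) \<oplus>\<^bsub>H\<^esub> \<chi> (rbop G x) y)
             \<ominus>\<^bsub>H\<^esub> \<Phi> (\<lbrakk>x, rbop G y\<rbrakk>\<^bsub>G\<^esub> \<oplus>\<^bsub>G\<^esub> \<lbrakk>rbop G x, y\<rbrakk>\<^bsub>G\<^esub>)
             \<oplus>\<^bsub>H\<^esub> \<psi> (rbop G x) (\<Phi> y) \<ominus>\<^bsub>H\<^esub> \<psi> (rbop G y) (\<Phi> x)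
             \<ominus>\<^bsub>H\<^esub> rbop H (\<psi> x (\<Phi> y) \<ominus>\<^bsub>H\<^esub> \<psi> y (\<Phi> x))
             \<oplus>\<^bsub>H\<^esub> \<lbrakk>\<Phi> x, \<Phi> y\<rbrakk>\<^bsub>H\<^esub> = \<zero>\<^bsub>H\<^esub>)}"

text \<open>
  Triples that agree on the carriers are related (take \<open>\<phi> = 0\<close>), so passing to classes
  also removes the dependence on values outside the carriers.
\<close>

definition nab_cocycle_equiv ::
  "('k, 'm) ring_scheme \<Rightarrow> ('k, 'g) rb_lie_alg \<Rightarrow> ('k, 'h) rb_lie_alg
    \<Rightarrow> ('g, 'h) nab_triple rel" where
  "nab_cocycle_equiv K G H =
     {((\<chi>, \<psi>, \<Phi>), (\<chi>', \<psi>', \<Phi>')).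
        (\<chi>, \<psi>, \<Phi>) \<in> nab_cocycles K G H \<and> (\<chi>', \<psi>', \<Phi>') \<in> nab_cocycles K G H \<and>
        (\<exists>\<phi>. linear_map K G H \<phi> \<and>
           (\<forall>x\<in>carrier G. \<forall>h\<in>carrier H. \<psi> x h \<ominus>\<^bsub>H\<^esub> \<psi>' x h = \<lbrakk>\<phi> x, h\<rbrakk>\<^bsub>H\<^esub>) \<and>
           (\<forall>x\<in>carrier G. \<forall>y\<in>carrier G.
              \<chi> x y \<ominus>\<^bsub>H\<^esub> \<chi>' x y =
                \<psi>' x (\<phi> y) \<ominus>\<^bsub>H\<^esub> \<psi>' y (\<phi> x) \<ominus>\<^bsub>H\<^esub> \<phi> \<lbrakk>x, y\<rbrakk>\<^bsub>G\<^esub> \<oplus>\<^bsub>H\<^esub> \<lbrakk>\<phi> x, \<phi> y\<rbrakk>\<^bsub>H\<^esub>) \<and>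
           (\<forall>x\<in>carrier G. \<Phi> x \<ominus>\<^bsub>H\<^esub> \<Phi>' x = rbop H (\<phi> x) \<ominus>\<^bsub>H\<^esub> \<phi> (rbop G x)))}"

definition H2_nab ::
  "('k, 'm) ring_scheme \<Rightarrow> ('k, 'g) rb_lie_alg \<Rightarrow> ('k, 'h) rb_lie_alg
    \<Rightarrow> ('g, 'h) nab_triple set set" where
  "H2_nab K G H = nab_cocycles K G H // nab_cocycle_equiv K G H"


section \<open>The cocycle of an extension\<close>

fun is_section ::
  "('k, 'm) ring_scheme \<Rightarrow> ('k, 'g) rb_lie_alg \<Rightarrow> ('k, 'g, 'h, 'e) rb_ext
    \<Rightarrow> ('g \<Rightarrow> 'e) \<Rightarrow> bool" where
  "is_section K G (E, i, p) s \<longleftrightarrow> linear_map K G E s \<and> (\<forall>x\<in>carrier G. p (s x) = x)"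

text \<open>
  The identification of \<open>H\<close> with its image under \<open>i\<close> is made explicit: \<open>i\<close> is applied to the
  argument of \<open>\<psi>\<close>, and results are pulled back along \<open>i\<close>.
\<close>

fun assoc_triple ::
  "('k, 'g) rb_lie_alg \<Rightarrow> ('k, 'h) rb_lie_alg \<Rightarrow> ('k, 'g, 'h, 'e) rb_ext
    \<Rightarrow> ('g \<Rightarrow> 'e) \<Rightarrow> ('g, 'h) nab_triple" where
  "assoc_triple G H (E, i, p) s =
     (\<lambda>x y. the_inv_into (carrier H) i (\<lbrakk>s x, s y\<rbrakk>\<^bsub>E\<^esub> \<ominus>\<^bsub>E\<^esub> s \<lbrakk>x, y\<rbrakk>\<^bsub>G\<^esub>),
      \<lambda>x h. the_inv_into (carrier H) i \<lbrakk>s x, i h\<rbrakk>\<^bsub>E\<^esub>,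
      \<lambda>x. the_inv_into (carrier H) i (rbop E (s x) \<ominus>\<^bsub>E\<^esub> s (rbop G x)))"

definition Upsilon ::
  "('k, 'm) ring_scheme \<Rightarrow> ('k, 'g) rb_lie_alg \<Rightarrow> ('k, 'h) rb_lie_alg
    \<Rightarrow> ('k, 'g, 'h, 'e) rb_ext set \<Rightarrow> ('g, 'h) nab_triple set" where
  "Upsilon K G H C =
     (THE c. \<exists>X\<in>C. \<exists>s. is_section K G X s \<and>
        c = nab_cocycle_equiv K G H `` {assoc_triple G H X s})"

end

theory Submission
  imports Defs
begin

text \<open>
  A section \<open>s\<close> of an extension \<open>E\<close> of \<open>G\<close> by \<open>H\<close> identifies \<open>E\<close> with \<open>G \<oplus> H\<close> as a vector space, by
  writing each element as \<open>s x + i h\<close>. In these coordinates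
  \<open>[s x + i h, s y + i k] = s [x, y] + i (\<psi> x k - \<psi> y h + [h, k] + \<chi> x y)\<close> and
  \<open>U (s x + i h) = s (T x) + i (S h + \<Phi> x)\<close>, where \<open>(\<chi>, \<psi>, \<Phi>)\<close> is the triple of \<open>s\<close>. An
  extension with a section is therefore determined by its triple, and everything reduces to the
  following four observations.

  The triple is a cocycle. Pulled back along the injection \<open>i\<close>, the cocycle conditions are instances
  of the Jacobi and Rota-Baxter identities of \<open>E\<close> (\<open>assoc_triple_cocycle\<close>). Conversely, for a
  cocycle the two formulas define a Rota-Baxter Lie algebra on \<open>G \<oplus> H\<close>, so every cocycle is the
  triple of an extension with a section (\<open>nab_cocycle_realised\<close>); the injection of
  \<open>G \<times> H\<close> into the type of the total spaces is what makes room for this extension.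

  Two extensions are equivalent if and only if they have sections with the same triple: an
  equivalence transports sections, and equal triples give the equivalence \<open>s x + i h \<mapsto> t x + i' h\<close>
  (\<open>nab_ext_equiv_transports_section\<close>, \<open>nab_ext_equivI_triples_agree\<close>).

  Replacing \<open>s\<close> by another section \<open>s + i \<phi>\<close>, with \<open>\<phi>\<close> linear from \<open>G\<close> to \<open>H\<close>, changes the triple
  exactly as equivalence of cocycles prescribes (\<open>gauge_related_change_section\<close>), and every such
  \<open>\<phi>\<close> occurs.

  Consequently extensions are equivalent if and only if the triples of any chosen sections
  are (\<open>nab_ext_equiv_iff_assoc_triple\<close>), which makes the map on classes well defined and
  injective; it is surjective because cocycles are realised. Sections exist because epimorphisms
  of vector spaces split (\<open>epimorphism_splits\<close>).
\<close>

(* Sections and triples stay opaque, so that facts about them apply before they are unfolded. *)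
declare is_section.simps [simp del] assoc_triple.simps [simp del]

section \<open>Additive identities and linear maps\<close>

lemma (in abelian_group) add_diff_eq:
  "\<lbrakk>x \<in> carrier G; y \<in> carrier G; z \<in> carrier G\<rbrakk> \<Longrightarrow> x \<oplus> (y \<ominus> z) = (x \<oplus> y) \<ominus> z"
  by (simp add: a_minus_def a_ac)

lemma (in abelian_group) diff_add_eq:
  "\<lbrakk>x \<in> carrier G; y \<in> carrier G; z \<in> carrier G\<rbrakk> \<Longrightarrow> (x \<ominus> y) \<oplus> z = (x \<oplus> z) \<ominus> y"
  by (simp add: a_minus_def a_ac)

lemma (in abelian_group) diff_diff_left:
  "\<lbrakk>x \<in> carrier G; y \<in> carrier G; z \<in> carrier G\<rbrakk> \<Longrightarrow> (x \<ominus> y) \<ominus> z = x \<ominus> (y \<oplus> z)"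
  by (simp add: a_minus_def a_ac minus_add)

lemma (in abelian_group) diff_diff_right:
  "\<lbrakk>x \<in> carrier G; y \<in> carrier G; z \<in> carrier G\<rbrakk> \<Longrightarrow> x \<ominus> (y \<ominus> z) = (x \<oplus> z) \<ominus> y"
  by (simp add: a_minus_def a_ac minus_add)

lemma (in abelian_group) diff_eq_iff:
  assumes "x \<in> carrier G" "y \<in> carrier G" "z \<in> carrier G"
  shows "x \<ominus> y = z \<longleftrightarrow> x = z \<oplus> y"
  using assms add.inv_solve_right[of z x y] unfolding a_minus_def by metis

lemma (in abelian_group) eq_diff_iff:
  "\<lbrakk>x \<in> carrier G; y \<in> carrier G; z \<in> carrier G\<rbrakk> \<Longrightarrow> z = x \<ominus> y \<longleftrightarrow> z \<oplus> y = x"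
  using diff_eq_iff by metis

lemma (in abelian_group) minus_zero_right: "x \<in> carrier G \<Longrightarrow> x \<ominus> \<zero> = x"
  by (simp add: a_minus_def)

lemma (in abelian_group) neg_eq_zero_diff: "x \<in> carrier G \<Longrightarrow> \<ominus> x = \<zero> \<ominus> x"
  by (simp add: a_minus_def)

text \<open>
  These rules bring an equation between signed sums to the form \<open>P = Q\<close> with \<open>P\<close> and \<open>Q\<close> sorted
  sums without signs. Such an equation holds in the free abelian group on its summands only if
  \<open>P\<close> and \<open>Q\<close> are literally equal, so rewriting with them decides all purely additive identities.
\<close>

lemmas (in abelian_group) additive_simps =
  add_diff_eq diff_add_eq diff_diff_left diff_diff_right diff_eq_iff eq_diff_iff
  minus_zero_right neg_eq_zero_diff a_ac

lemma linear_mapD: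
  assumes "linear_map K V W f"
  shows linear_map_closed: "x \<in> carrier V \<Longrightarrow> f x \<in> carrier W"
    and linear_map_add:
      "\<lbrakk>x \<in> carrier V; y \<in> carrier V\<rbrakk> \<Longrightarrow> f (x \<oplus>\<^bsub>V\<^esub> y) = f x \<oplus>\<^bsub>W\<^esub> f y"
    and linear_map_smult:
      "\<lbrakk>a \<in> carrier K; x \<in> carrier V\<rbrakk> \<Longrightarrow> f (a \<odot>\<^bsub>V\<^esub> x) = a \<odot>\<^bsub>W\<^esub> f x"
  using assms by (auto simp: linear_map_def)

lemma linear_map_zero:
  assumes "linear_map K V W f" "abelian_group V" "abelian_group W"
  shows "f \<zero>\<^bsub>V\<^esub> = \<zero>\<^bsub>W\<^esub>"
proof -
  interpret V: abelian_group V by fact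
  interpret W: abelian_group W by fact
  note f = linear_mapD[OF assms(1)]
  have "f \<zero>\<^bsub>V\<^esub> \<oplus>\<^bsub>W\<^esub> f \<zero>\<^bsub>V\<^esub> = f \<zero>\<^bsub>V\<^esub>"
    using f(2)[of "\<zero>\<^bsub>V\<^esub>" "\<zero>\<^bsub>V\<^esub>"] by simp
  then show ?thesis using f(1)[of "\<zero>\<^bsub>V\<^esub>"] by simp
qed

lemma linear_map_diff:
  assumes "linear_map K V W f" "abelian_group V" "abelian_group W"
    and "x \<in> carrier V" "y \<in> carrier V"
  shows "f (x \<ominus>\<^bsub>V\<^esub> y) = f x \<ominus>\<^bsub>W\<^esub> f y"
proof -
  interpret V: abelian_group V by fact
  interpret W: abelian_group W by fact
  note f = linear_mapD[OF assms(1)]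
  have "f (x \<ominus>\<^bsub>V\<^esub> y) \<oplus>\<^bsub>W\<^esub> f y = f ((x \<ominus>\<^bsub>V\<^esub> y) \<oplus>\<^bsub>V\<^esub> y)"
    using assms(4,5) f(2) by simp
  also have "(x \<ominus>\<^bsub>V\<^esub> y) \<oplus>\<^bsub>V\<^esub> y = x"
    using assms(4,5) by (simp add: V.additive_simps)
  finally show ?thesis
    using assms(4,5) f(1) by (simp add: W.eq_diff_iff)
qed

lemma (in module) smult_diff_distr:
  "\<lbrakk>a \<in> carrier R; x \<in> carrier M; y \<in> carrier M\<rbrakk>
    \<Longrightarrow> a \<odot>\<^bsub>M\<^esub> (x \<ominus>\<^bsub>M\<^esub> y) = a \<odot>\<^bsub>M\<^esub> x \<ominus>\<^bsub>M\<^esub> a \<odot>\<^bsub>M\<^esub> y"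
  by (simp add: a_minus_def smult_r_distr smult_r_minus)

text \<open>
  Over a field every epimorphism of vector spaces splits. A submodule maximal among those meeting
  the kernel trivially is mapped bijectively onto the target, since otherwise it could be enlarged
  by a line; inverting this bijection gives the section.
\<close>

lemma epimorphism_splits:
  assumes "field K" "module K V" "module K W"
    and lin: "linear_map K V W p" and surj: "p ` carrier V = carrier W"
  shows "\<exists>s. linear_map K W V s \<and> (\<forall>x\<in>carrier W. p (s x) = x)"
proof -
  interpret K: field K by fact
  interpret V: module K V by fact
  interpret W: module K W by fact
  note p = linear_mapD[OF lin]
  have p_zero: "p \<zero>\<^bsub>V\<^esub> = \<zero>\<^bsub>W\<^esub>"
    and p_diff: "\<And>x y. x \<in> carrier V \<Longrightarrow> y \<in> carrier V \<Longrightarrow> p (x \<ominus>\<^bsub>V\<^esub> y) = p x \<ominus>\<^bsub>W\<^esub> p y"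
    using linear_map_zero[OF lin] linear_map_diff[OF lin] V.M.abelian_group_axioms
      W.M.abelian_group_axioms by auto
  define \<A> where "\<A> = {C. submodule C K V \<and> (\<forall>c\<in>C. p c = \<zero>\<^bsub>W\<^esub> \<longrightarrow> c = \<zero>\<^bsub>V\<^esub>)}"
  have "{\<zero>\<^bsub>V\<^esub>} \<in> \<A>"
    unfolding \<A>_def by (auto intro!: V.submoduleI)
  then have "\<A> \<noteq> {}" by auto
  moreover have "\<Union>\<C> \<in> \<A>" if "\<C> \<noteq> {}" and chain: "subset.chain \<A> \<C>" for \<C>
  proof -
    have sub: "submodule C K V" and ker: "\<forall>c\<in>C. p c = \<zero>\<^bsub>W\<^esub> \<longrightarrow> c = \<zero>\<^bsub>V\<^esub>" if "C \<in> \<C>" for C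
      using chain that by (auto simp: subset.chain_def \<A>_def)
    have tot: "C \<subseteq> D \<or> D \<subseteq> C" if "C \<in> \<C>" "D \<in> \<C>" for C D
      using chain that by (auto simp: subset.chain_def)
    have "submodule (\<Union>\<C>) K V"
    proof (rule V.submoduleI)
      show "\<Union>\<C> \<subseteq> carrier V" using V.submoduleE(1)[OF sub] by auto
      show "\<zero>\<^bsub>V\<^esub> \<in> \<Union>\<C>"
      proof -
        obtain C where C: "C \<in> \<C>" using \<open>\<C> \<noteq> {}\<close> by auto
        interpret C: submodule C K V by (rule sub[OF C])
        show ?thesis using C.one_closed C by auto
      qed
      show "\<ominus>\<^bsub>V\<^esub> a \<in> \<Union>\<C>" if "a \<in> \<Union>\<C>" for a
        using V.submoduleE(3)[OF sub] that by blast
      show "a \<oplus>\<^bsub>V\<^esub> b \<in> \<Union>\<C>" if ab: "a \<in> \<Union>\<C>" "b \<in> \<Union>\<C>" for a b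
      proof -
        obtain C D where CD: "C \<in> \<C>" "a \<in> C" "D \<in> \<C>" "b \<in> D" using ab by auto
        from tot[OF CD(1,3)] show ?thesis
        proof
          assume "C \<subseteq> D"
          then show ?thesis using V.submoduleE(5)[OF sub[OF CD(3)]] CD by blast
        next
          assume "D \<subseteq> C"
          then show ?thesis using V.submoduleE(5)[OF sub[OF CD(1)]] CD by blast
        qed
      qed
      show "k \<odot>\<^bsub>V\<^esub> a \<in> \<Union>\<C>" if "k \<in> carrier K" "a \<in> \<Union>\<C>" for k a
        using V.submoduleE(4)[OF sub] that by blast
    qed
    then show ?thesis using ker by (auto simp: \<A>_def)
  qed
  ultimately obtain C where C: "C \<in> \<A>" and max: "\<And>D. D \<in> \<A> \<Longrightarrow> C \<subseteq> D \<Longrightarrow> D = C"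
    using subset_Zorn_nonempty[of \<A>] by metis
  have sub: "submodule C K V" and ker: "\<And>c. c \<in> C \<Longrightarrow> p c = \<zero>\<^bsub>W\<^esub> \<Longrightarrow> c = \<zero>\<^bsub>V\<^esub>"
    using C by (auto simp: \<A>_def)
  note C_closed = V.submoduleE[OF sub]
  have CV: "c \<in> C \<Longrightarrow> c \<in> carrier V" for c using C_closed(1) by auto
  have zero_C: "\<zero>\<^bsub>V\<^esub> \<in> C"
    using C_closed(2,4) CV by (metis K.zero_closed V.smult_l_null ex_in_conv)
  have diff_C: "a \<ominus>\<^bsub>V\<^esub> b \<in> C" if "a \<in> C" "b \<in> C" for a b
    using that C_closed(3,5) by (simp add: a_minus_def)
  have onto: "\<exists>c\<in>C. p c = x" if x: "x \<in> carrier W" for x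
  proof (rule ccontr)
    assume no: "\<not> (\<exists>c\<in>C. p c = x)"
    obtain e where e: "e \<in> carrier V" "p e = x" using x by (auto simp flip: surj)
    define D where "D = {c \<oplus>\<^bsub>V\<^esub> k \<odot>\<^bsub>V\<^esub> e |c k. c \<in> C \<and> k \<in> carrier K}"
    have DI: "d \<in> D" if "c \<in> C" "k \<in> carrier K" "d = c \<oplus>\<^bsub>V\<^esub> k \<odot>\<^bsub>V\<^esub> e" for c k d
      using that by (auto simp: D_def)
    have "submodule D K V"
    proof (rule V.submoduleI)
      show "D \<subseteq> carrier V" using e CV by (auto simp: D_def)
      show "\<zero>\<^bsub>V\<^esub> \<in> D"
        by (rule DI[of "\<zero>\<^bsub>V\<^esub>" "\<zero>\<^bsub>K\<^esub>"]) (use zero_C e in auto)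
      show "\<ominus>\<^bsub>V\<^esub> d \<in> D" if "d \<in> D" for d
      proof -
        obtain c k where d: "c \<in> C" "k \<in> carrier K" "d = c \<oplus>\<^bsub>V\<^esub> k \<odot>\<^bsub>V\<^esub> e"
          using \<open>d \<in> D\<close> by (auto simp: D_def)
        show ?thesis
          by (rule DI[of "\<ominus>\<^bsub>V\<^esub> c" "\<ominus>\<^bsub>K\<^esub> k"])
            (use d e CV C_closed(3) in \<open>auto simp: V.minus_add V.smult_l_minus\<close>)
      qed
      show "d \<oplus>\<^bsub>V\<^esub> d' \<in> D" if "d \<in> D" "d' \<in> D" for d d'
      proof -
        obtain c k c' k' where d: "c \<in> C" "k \<in> carrier K" "d = c \<oplus>\<^bsub>V\<^esub> k \<odot>\<^bsub>V\<^esub> e"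
          "c' \<in> C" "k' \<in> carrier K" "d' = c' \<oplus>\<^bsub>V\<^esub> k' \<odot>\<^bsub>V\<^esub> e"
          using \<open>d \<in> D\<close> \<open>d' \<in> D\<close> by (auto simp: D_def)
        show ?thesis
          by (rule DI[of "c \<oplus>\<^bsub>V\<^esub> c'" "k \<oplus>\<^bsub>K\<^esub> k'"])
            (use d e CV C_closed(5) in \<open>auto simp: V.smult_l_distr V.M.a_ac\<close>)
      qed
      show "a \<odot>\<^bsub>V\<^esub> d \<in> D" if a: "a \<in> carrier K" and "d \<in> D" for a d
      proof -
        obtain c k where d: "c \<in> C" "k \<in> carrier K" "d = c \<oplus>\<^bsub>V\<^esub> k \<odot>\<^bsub>V\<^esub> e"
          using \<open>d \<in> D\<close> by (auto simp: D_def)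
        show ?thesis
          by (rule DI[of "a \<odot>\<^bsub>V\<^esub> c" "a \<otimes>\<^bsub>K\<^esub> k"])
            (use d e a CV C_closed(4) in \<open>auto simp: V.smult_r_distr V.smult_assoc1\<close>)
      qed
    qed
    moreover have "d = \<zero>\<^bsub>V\<^esub>" if "d \<in> D" and pd: "p d = \<zero>\<^bsub>W\<^esub>" for d
    proof -
      obtain c k where d: "c \<in> C" "k \<in> carrier K" "d = c \<oplus>\<^bsub>V\<^esub> k \<odot>\<^bsub>V\<^esub> e"
        using \<open>d \<in> D\<close> by (auto simp: D_def)
      have eq: "p c \<oplus>\<^bsub>W\<^esub> k \<odot>\<^bsub>W\<^esub> x = \<zero>\<^bsub>W\<^esub>"
        using pd d e CV p by auto
      \<comment> \<open>a nonzero \<open>k\<close> would exhibit \<open>x\<close> as the image of \<open>- c / k\<close>\<close>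
      have "k = \<zero>\<^bsub>K\<^esub>"
      proof (rule ccontr)
        assume "k \<noteq> \<zero>\<^bsub>K\<^esub>"
        then have k: "k \<in> Units K" using d K.field_Units by auto
        have ik: "inv\<^bsub>K\<^esub> k \<in> carrier K" "inv\<^bsub>K\<^esub> k \<otimes>\<^bsub>K\<^esub> k = \<one>\<^bsub>K\<^esub>" using k by auto
        have kx: "k \<odot>\<^bsub>W\<^esub> x = \<ominus>\<^bsub>W\<^esub> p c"
          using eq d x p(1) CV
          by (metis W.M.minus_equality W.M.minus_minus W.smult_closed)
        have "x = inv\<^bsub>K\<^esub> k \<odot>\<^bsub>W\<^esub> (k \<odot>\<^bsub>W\<^esub> x)"
          using ik d x by (simp flip: W.smult_assoc1)
        also have "\<dots> = p (inv\<^bsub>K\<^esub> k \<odot>\<^bsub>V\<^esub> (\<zero>\<^bsub>V\<^esub> \<ominus>\<^bsub>V\<^esub> c))"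
          using ik d CV kx p p_diff[of "\<zero>\<^bsub>V\<^esub>" c] p_zero by (simp add: a_minus_def)
        finally show False
          using no ik d C_closed(4) diff_C zero_C by metis
      qed
      then show ?thesis using ker[OF d(1)] pd d e CV by simp
    qed
    ultimately have "D \<in> \<A>" by (auto simp: \<A>_def)
    moreover have "C \<subseteq> D"
    proof
      fix c assume "c \<in> C"
      then show "c \<in> D" by (intro DI[of c "\<zero>\<^bsub>K\<^esub>"]) (use e CV in auto)
    qed
    moreover have "e \<in> D" by (rule DI[of "\<zero>\<^bsub>V\<^esub>" "\<one>\<^bsub>K\<^esub>"]) (use zero_C e in auto)
    ultimately show False using max no e by auto
  qed
  define s where "s x = (SOME c. c \<in> C \<and> p c = x)" for x
  have s: "s x \<in> C" "p (s x) = x" if "x \<in> carrier W" for x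
    using someI_ex[of "\<lambda>c. c \<in> C \<and> p c = x"] onto[OF that] by (auto simp: s_def)
  have s_unique: "s x = c" if "c \<in> C" "p c = x" "x \<in> carrier W" for x c
  proof -
    have "s x \<ominus>\<^bsub>V\<^esub> c = \<zero>\<^bsub>V\<^esub>"
      using that s CV by (intro ker diff_C) (auto simp: p_diff p W.diff_eq_iff)
    then show ?thesis using that s CV by (simp add: V.diff_eq_iff)
  qed
  have "linear_map K W V s"
    unfolding linear_map_def using s CV p C_closed(4,5)
    by (auto intro!: s_unique)
  then show ?thesis using s by blast
qed

section \<open>Brackets, derivations and Rota-Baxter operators\<close>

context lie_algebra
begin

declare bracket_closed [simp]

lemma bracket_linear_left:
  "y \<in> carrier L \<Longrightarrow> linear_map K L L (\<lambda>x. \<lbrakk>x, y\<rbrakk>\<^bsub>L\<^esub>)"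
  by (simp add: linear_map_def bracket_add_left bracket_smult_left)

lemma bracket_linear_right:
  "x \<in> carrier L \<Longrightarrow> linear_map K L L (\<lambda>y. \<lbrakk>x, y\<rbrakk>\<^bsub>L\<^esub>)"
  by (simp add: linear_map_def bracket_add_right bracket_smult_right)

lemma bracket_zero_left: "y \<in> carrier L \<Longrightarrow> \<lbrakk>\<zero>\<^bsub>L\<^esub>, y\<rbrakk>\<^bsub>L\<^esub> = \<zero>\<^bsub>L\<^esub>"
  using linear_map_zero[OF bracket_linear_left] M.abelian_group_axioms by simp

lemma bracket_zero_right: "x \<in> carrier L \<Longrightarrow> \<lbrakk>x, \<zero>\<^bsub>L\<^esub>\<rbrakk>\<^bsub>L\<^esub> = \<zero>\<^bsub>L\<^esub>"
  using linear_map_zero[OF bracket_linear_right] M.abelian_group_axioms by simp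

lemma bracket_diff_left:
  "\<lbrakk>x \<in> carrier L; y \<in> carrier L; z \<in> carrier L\<rbrakk>
    \<Longrightarrow> \<lbrakk>x \<ominus>\<^bsub>L\<^esub> y, z\<rbrakk>\<^bsub>L\<^esub> = \<lbrakk>x, z\<rbrakk>\<^bsub>L\<^esub> \<ominus>\<^bsub>L\<^esub> \<lbrakk>y, z\<rbrakk>\<^bsub>L\<^esub>"
  using linear_map_diff[OF bracket_linear_left] M.abelian_group_axioms by simp

lemma bracket_diff_right:
  "\<lbrakk>x \<in> carrier L; y \<in> carrier L; z \<in> carrier L\<rbrakk>
    \<Longrightarrow> \<lbrakk>x, y \<ominus>\<^bsub>L\<^esub> z\<rbrakk>\<^bsub>L\<^esub> = \<lbrakk>x, y\<rbrakk>\<^bsub>L\<^esub> \<ominus>\<^bsub>L\<^esub> \<lbrakk>x, z\<rbrakk>\<^bsub>L\<^esub>"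
  using linear_map_diff[OF bracket_linear_right] M.abelian_group_axioms by simp

lemmas bracket_simps =
  bracket_add_left bracket_add_right bracket_diff_left bracket_diff_right
  bracket_zero_left bracket_zero_right

lemma bracket_antisym:
  assumes "x \<in> carrier L" "y \<in> carrier L"
  shows "\<lbrakk>x, y\<rbrakk>\<^bsub>L\<^esub> = \<zero>\<^bsub>L\<^esub> \<ominus>\<^bsub>L\<^esub> \<lbrakk>y, x\<rbrakk>\<^bsub>L\<^esub>"
proof -
  have "\<lbrakk>x \<oplus>\<^bsub>L\<^esub> y, x \<oplus>\<^bsub>L\<^esub> y\<rbrakk>\<^bsub>L\<^esub> = \<zero>\<^bsub>L\<^esub>"
    using assms by (intro bracket_self) simp
  then show ?thesis
    using assms by (simp add: bracket_simps bracket_self[OF assms(1)] bracket_self[OF assms(2)]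
      M.additive_simps)
qed

text \<open>
  The Jacobi identity, oriented for rewriting: the outer bracket with a chosen \<open>x\<close> is expanded.
\<close>

lemma bracket_derivation:
  assumes "x \<in> carrier L" "y \<in> carrier L" "z \<in> carrier L"
  shows "\<lbrakk>x, \<lbrakk>y, z\<rbrakk>\<^bsub>L\<^esub>\<rbrakk>\<^bsub>L\<^esub> = \<lbrakk>\<lbrakk>x, y\<rbrakk>\<^bsub>L\<^esub>, z\<rbrakk>\<^bsub>L\<^esub> \<oplus>\<^bsub>L\<^esub> \<lbrakk>y, \<lbrakk>x, z\<rbrakk>\<^bsub>L\<^esub>\<rbrakk>\<^bsub>L\<^esub>"
proof -
  have "\<lbrakk>y, \<lbrakk>z, x\<rbrakk>\<^bsub>L\<^esub>\<rbrakk>\<^bsub>L\<^esub> = \<zero>\<^bsub>L\<^esub> \<ominus>\<^bsub>L\<^esub> \<lbrakk>y, \<lbrakk>x, z\<rbrakk>\<^bsub>L\<^esub>\<rbrakk>\<^bsub>L\<^esub>"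
    using assms by (simp add: bracket_antisym[of z x] bracket_simps)
  moreover have "\<lbrakk>z, \<lbrakk>x, y\<rbrakk>\<^bsub>L\<^esub>\<rbrakk>\<^bsub>L\<^esub> = \<zero>\<^bsub>L\<^esub> \<ominus>\<^bsub>L\<^esub> \<lbrakk>\<lbrakk>x, y\<rbrakk>\<^bsub>L\<^esub>, z\<rbrakk>\<^bsub>L\<^esub>"
    using assms by (intro bracket_antisym) simp_all
  moreover have "\<lbrakk>x, \<lbrakk>y, z\<rbrakk>\<^bsub>L\<^esub>\<rbrakk>\<^bsub>L\<^esub> = \<zero>\<^bsub>L\<^esub> \<ominus>\<^bsub>L\<^esub> (\<lbrakk>y, \<lbrakk>z, x\<rbrakk>\<^bsub>L\<^esub>\<rbrakk>\<^bsub>L\<^esub> \<oplus>\<^bsub>L\<^esub> \<lbrakk>z, \<lbrakk>x, y\<rbrakk>\<^bsub>L\<^esub>\<rbrakk>\<^bsub>L\<^esub>)"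
    using jacobi[OF assms] assms by (simp add: M.additive_simps)
  ultimately show ?thesis
    using assms by (simp only:) (simp add: M.additive_simps)
qed

end

context rb_lie_algebra
begin

lemmas rbop_closed [simp] = linear_map_closed[OF rbop_linear]
  and rbop_add = linear_map_add[OF rbop_linear]
  and rbop_smult = linear_map_smult[OF rbop_linear]

lemma rbop_zero: "rbop L \<zero>\<^bsub>L\<^esub> = \<zero>\<^bsub>L\<^esub>"
  using linear_map_zero[OF rbop_linear] M.abelian_group_axioms by simp

lemma rbop_diff:
  "\<lbrakk>x \<in> carrier L; y \<in> carrier L\<rbrakk> \<Longrightarrow> rbop L (x \<ominus>\<^bsub>L\<^esub> y) = rbop L x \<ominus>\<^bsub>L\<^esub> rbop L y"
  using linear_map_diff[OF rbop_linear] M.abelian_group_axioms by simp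

lemmas rbop_simps = rbop_add rbop_diff rbop_zero

end

section \<open>The cocycle of an extension with a section\<close>

locale nab_extension =
  G: rb_lie_algebra K G + H: rb_lie_algebra K H + E: rb_lie_algebra K E
  for K :: "('k, 'm) ring_scheme" and G :: "('k, 'g) rb_lie_alg"
    and H :: "('k, 'h) rb_lie_alg" and E :: "('k, 'e) rb_lie_alg" +
  fixes i :: "'h \<Rightarrow> 'e" and p :: "'e \<Rightarrow> 'g"
  assumes i_hom: "rb_lie_hom K H E i" and p_hom: "rb_lie_hom K E G p"
    and i_inj: "inj_on i (carrier H)"
    and exact: "i ` carrier H = a_kernel E G p"
    and p_surj: "p ` carrier E = carrier G"
begin

lemma i_linear: "linear_map K H E i" and p_linear: "linear_map K E G p"
  using i_hom p_hom by (auto simp: rb_lie_hom_def)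

lemmas i_closed [simp] = linear_map_closed[OF i_linear]
  and i_add = linear_map_add[OF i_linear]
  and i_smult = linear_map_smult[OF i_linear]
  and i_diff = linear_map_diff[OF i_linear H.M.abelian_group_axioms E.M.abelian_group_axioms]
  and i_zero = linear_map_zero[OF i_linear H.M.abelian_group_axioms E.M.abelian_group_axioms]
  and p_closed [simp] = linear_map_closed[OF p_linear]
  and p_add = linear_map_add[OF p_linear]
  and p_diff = linear_map_diff[OF p_linear E.M.abelian_group_axioms G.M.abelian_group_axioms]
  and p_zero = linear_map_zero[OF p_linear E.M.abelian_group_axioms G.M.abelian_group_axioms]

lemma i_bracket: "\<lbrakk>h \<in> carrier H; k \<in> carrier H\<rbrakk> \<Longrightarrow> i \<lbrakk>h, k\<rbrakk>\<^bsub>H\<^esub> = \<lbrakk>i h, i k\<rbrakk>\<^bsub>E\<^esub>"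
  and i_rbop: "h \<in> carrier H \<Longrightarrow> i (rbop H h) = rbop E (i h)"
  using i_hom by (auto simp: rb_lie_hom_def)

lemma p_bracket: "\<lbrakk>u \<in> carrier E; v \<in> carrier E\<rbrakk> \<Longrightarrow> p \<lbrakk>u, v\<rbrakk>\<^bsub>E\<^esub> = \<lbrakk>p u, p v\<rbrakk>\<^bsub>G\<^esub>"
  and p_rbop: "u \<in> carrier E \<Longrightarrow> p (rbop E u) = rbop G (p u)"
  using p_hom by (auto simp: rb_lie_hom_def)

lemma p_i [simp]: "h \<in> carrier H \<Longrightarrow> p (i h) = \<zero>\<^bsub>G\<^esub>"
  using exact by (auto simp: a_kernel_def')

lemma i_eq_iff [simp]: "\<lbrakk>h \<in> carrier H; k \<in> carrier H\<rbrakk> \<Longrightarrow> i h = i k \<longleftrightarrow> h = k"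
  using i_inj by (auto simp: inj_on_def)

definition i_inv :: "'e \<Rightarrow> 'h" where "i_inv = the_inv_into (carrier H) i"

lemma i_inv_i [simp]: "h \<in> carrier H \<Longrightarrow> i_inv (i h) = h"
  using i_inj by (simp add: i_inv_def the_inv_into_f_f)

lemma
  assumes "u \<in> carrier E" "p u = \<zero>\<^bsub>G\<^esub>"
  shows i_inv_closed [simp]: "i_inv u \<in> carrier H" and i_i_inv [simp]: "i (i_inv u) = u"
proof -
  have "u \<in> i ` carrier H" using assms exact by (auto simp: a_kernel_def')
  then show "i_inv u \<in> carrier H" "i (i_inv u) = u" by auto
qed

lemmas i_simps = i_add i_diff i_zero i_bracket i_rbop
lemmas p_simps = p_add p_diff p_zero p_bracket p_rbop

end

lemma nab_extension_iff:
  fixes E :: "('k, 'e) rb_lie_alg"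
  assumes "rb_lie_algebra K G" "rb_lie_algebra K H"
  shows "(E, i, p) \<in> nab_extensions K G H \<longleftrightarrow> nab_extension K G H E i p"
  using assms
  by (auto simp: nab_extensions_def nab_extension_def nab_extension_axioms_def)

locale split_nab_extension = nab_extension K G H E i p
  for K :: "('k, 'm) ring_scheme" and G :: "('k, 'g) rb_lie_alg"
    and H :: "('k, 'h) rb_lie_alg" and E :: "('k, 'e) rb_lie_alg" and i p +
  fixes s :: "'g \<Rightarrow> 'e"
  assumes is_section: "is_section K G (E, i, p) s"
begin

lemma s_linear: "linear_map K G E s" and p_s [simp]: "x \<in> carrier G \<Longrightarrow> p (s x) = x"
  using is_section by (auto simp: is_section.simps)

lemmas s_closed [simp] = linear_map_closed[OF s_linear]
  and s_add = linear_map_add[OF s_linear]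
  and s_smult = linear_map_smult[OF s_linear]
  and s_diff = linear_map_diff[OF s_linear G.M.abelian_group_axioms E.M.abelian_group_axioms]
  and s_zero = linear_map_zero[OF s_linear G.M.abelian_group_axioms E.M.abelian_group_axioms]

lemmas s_simps = s_add s_diff s_zero

definition chi :: "'g \<Rightarrow> 'g \<Rightarrow> 'h" where
  "chi x y = i_inv (\<lbrakk>s x, s y\<rbrakk>\<^bsub>E\<^esub> \<ominus>\<^bsub>E\<^esub> s \<lbrakk>x, y\<rbrakk>\<^bsub>G\<^esub>)"

definition psi :: "'g \<Rightarrow> 'h \<Rightarrow> 'h" where
  "psi x h = i_inv \<lbrakk>s x, i h\<rbrakk>\<^bsub>E\<^esub>"

definition Phi :: "'g \<Rightarrow> 'h" where
  "Phi x = i_inv (rbop E (s x) \<ominus>\<^bsub>E\<^esub> s (rbop G x))"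

lemma assoc_triple_eq: "assoc_triple G H (E, i, p) s = (chi, psi, Phi)"
  by (simp add: assoc_triple.simps chi_def psi_def Phi_def i_inv_def fun_eq_iff)

lemma
  assumes "x \<in> carrier G" "y \<in> carrier G"
  shows chi_closed [simp]: "chi x y \<in> carrier H"
    and i_chi: "i (chi x y) = \<lbrakk>s x, s y\<rbrakk>\<^bsub>E\<^esub> \<ominus>\<^bsub>E\<^esub> s \<lbrakk>x, y\<rbrakk>\<^bsub>G\<^esub>"
  using assms by (simp_all add: chi_def p_simps G.M.additive_simps)

lemma
  assumes "x \<in> carrier G" "h \<in> carrier H"
  shows psi_closed [simp]: "psi x h \<in> carrier H"
    and i_psi: "i (psi x h) = \<lbrakk>s x, i h\<rbrakk>\<^bsub>E\<^esub>"
  using assms by (simp_all add: psi_def p_simps G.bracket_simps)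

lemma
  assumes "x \<in> carrier G"
  shows Phi_closed [simp]: "Phi x \<in> carrier H"
    and i_Phi: "i (Phi x) = rbop E (s x) \<ominus>\<^bsub>E\<^esub> s (rbop G x)"
  using assms by (simp_all add: Phi_def p_simps G.M.additive_simps)

lemmas i_triple = i_chi i_psi i_Phi

text \<open>Identities in \<open>H\<close> are proved by mapping them into \<open>E\<close>, where the triple has a formula.\<close>

lemma i_eqD: "\<lbrakk>i h = i k; h \<in> carrier H; k \<in> carrier H\<rbrakk> \<Longrightarrow> h = k"
  by simp

lemma chi_alternating: "alternating_bilinear K G H chi"
proof -
  have "chi x (y \<oplus>\<^bsub>G\<^esub> z) = chi x y \<oplus>\<^bsub>H\<^esub> chi x z"
    if "x \<in> carrier G" "y \<in> carrier G" "z \<in> carrier G" for x y z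
    by (rule i_eqD) (use that in \<open>simp_all add: i_simps i_triple s_simps G.bracket_simps
      E.bracket_simps E.M.additive_simps\<close>)
  moreover have "chi (x \<oplus>\<^bsub>G\<^esub> y) z = chi x z \<oplus>\<^bsub>H\<^esub> chi y z"
    if "x \<in> carrier G" "y \<in> carrier G" "z \<in> carrier G" for x y z
    by (rule i_eqD) (use that in \<open>simp_all add: i_simps i_triple s_simps G.bracket_simps
      E.bracket_simps E.M.additive_simps\<close>)
  moreover have "chi x (a \<odot>\<^bsub>G\<^esub> y) = a \<odot>\<^bsub>H\<^esub> chi x y"
    if "a \<in> carrier K" "x \<in> carrier G" "y \<in> carrier G" for a x y
    by (rule i_eqD) (use that in \<open>simp_all add: i_smult i_triple s_smult G.bracket_smult_right
      E.bracket_smult_right E.smult_diff_distr\<close>)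
  moreover have "chi (a \<odot>\<^bsub>G\<^esub> x) y = a \<odot>\<^bsub>H\<^esub> chi x y"
    if "a \<in> carrier K" "x \<in> carrier G" "y \<in> carrier G" for a x y
    by (rule i_eqD) (use that in \<open>simp_all add: i_smult i_triple s_smult G.bracket_smult_left
      E.bracket_smult_left E.smult_diff_distr\<close>)
  moreover have "chi x x = \<zero>\<^bsub>H\<^esub>" if "x \<in> carrier G" for x
    by (rule i_eqD) (use that in \<open>simp_all add: i_simps i_triple s_simps G.bracket_self
      E.bracket_self E.M.additive_simps\<close>)
  ultimately show ?thesis
    by (auto simp: alternating_bilinear_def linear_map_def)
qed

lemma psi_derivation: "x \<in> carrier G \<Longrightarrow> derivation K H (psi x)"
  unfolding derivation_def linear_map_def
proof (intro conjI ballI)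
  assume x: "x \<in> carrier G"
  then show "psi x \<in> carrier H \<rightarrow> carrier H" by auto
  fix h assume h: "h \<in> carrier H"
  show "psi x (a \<odot>\<^bsub>H\<^esub> h) = a \<odot>\<^bsub>H\<^esub> psi x h" if "a \<in> carrier K" for a
    by (rule i_eqD) (use x h that in \<open>simp_all add: i_smult i_triple E.bracket_smult_right\<close>)
  fix k assume k: "k \<in> carrier H"
  show "psi x (h \<oplus>\<^bsub>H\<^esub> k) = psi x h \<oplus>\<^bsub>H\<^esub> psi x k"
    by (rule i_eqD) (use x h k in \<open>simp_all add: i_simps i_triple E.bracket_simps\<close>)
  show "psi x \<lbrakk>h, k\<rbrakk>\<^bsub>H\<^esub> = \<lbrakk>psi x h, k\<rbrakk>\<^bsub>H\<^esub> \<oplus>\<^bsub>H\<^esub> \<lbrakk>h, psi x k\<rbrakk>\<^bsub>H\<^esub>"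
    by (rule i_eqD)
      (use x h k in \<open>simp_all add: i_simps i_triple E.bracket_derivation[of "s x"]\<close>)
qed

lemma psi_linear: "h \<in> carrier H \<Longrightarrow> linear_map K G H (\<lambda>x. psi x h)"
  unfolding linear_map_def
proof (intro conjI ballI)
  assume h: "h \<in> carrier H"
  then show "(\<lambda>x. psi x h) \<in> carrier G \<rightarrow> carrier H" by auto
  fix x assume x: "x \<in> carrier G"
  show "psi (a \<odot>\<^bsub>G\<^esub> x) h = a \<odot>\<^bsub>H\<^esub> psi x h" if "a \<in> carrier K" for a
    by (rule i_eqD) (use x h that in \<open>simp_all add: i_smult i_triple s_smult E.bracket_smult_left\<close>)
  show "psi (x \<oplus>\<^bsub>G\<^esub> y) h = psi x h \<oplus>\<^bsub>H\<^esub> psi y h" if "y \<in> carrier G" for y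
    by (rule i_eqD) (use x h that in \<open>simp_all add: i_simps i_triple s_simps E.bracket_simps\<close>)
qed

lemma Phi_linear: "linear_map K G H Phi"
  unfolding linear_map_def
proof (intro conjI ballI)
  show "Phi \<in> carrier G \<rightarrow> carrier H" by auto
  fix x assume x: "x \<in> carrier G"
  show "Phi (a \<odot>\<^bsub>G\<^esub> x) = a \<odot>\<^bsub>H\<^esub> Phi x" if "a \<in> carrier K" for a
    by (rule i_eqD) (use x that in \<open>simp_all add: i_smult i_triple s_smult G.rbop_smult
      E.rbop_smult E.smult_diff_distr\<close>)
  show "Phi (x \<oplus>\<^bsub>G\<^esub> y) = Phi x \<oplus>\<^bsub>H\<^esub> Phi y" if "y \<in> carrier G" for y
    by (rule i_eqD) (use x that in \<open>simp_all add: i_simps i_triple s_simps G.rbop_simps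
      E.rbop_simps E.M.additive_simps\<close>)
qed

text \<open>
  The four cocycle identities, mapped into \<open>E\<close> by the injection \<open>i\<close>: the Jacobi identity for
  \<open>(s x, s y, i h)\<close> and \<open>(s x, s y, s z)\<close>, and the Rota-Baxter identity for \<open>(s x, i h)\<close>
  and \<open>(s x, s y)\<close>.
\<close>

lemma psi_commutator:
  assumes "x \<in> carrier G" "y \<in> carrier G" "h \<in> carrier H"
  shows "psi x (psi y h) \<ominus>\<^bsub>H\<^esub> psi y (psi x h) \<ominus>\<^bsub>H\<^esub> psi \<lbrakk>x, y\<rbrakk>\<^bsub>G\<^esub> h = \<lbrakk>chi x y, h\<rbrakk>\<^bsub>H\<^esub>"
  by (rule i_eqD) (use assms in \<open>simp_all add: i_simps i_triple E.bracket_simps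
    E.bracket_derivation[of "s x" "s y" "i h"] E.M.additive_simps\<close>)

lemma chi_cocycle:
  assumes "x \<in> carrier G" "y \<in> carrier G" "z \<in> carrier G"
  shows "psi x (chi y z) \<oplus>\<^bsub>H\<^esub> psi y (chi z x) \<oplus>\<^bsub>H\<^esub> psi z (chi x y)
    \<ominus>\<^bsub>H\<^esub> chi \<lbrakk>x, y\<rbrakk>\<^bsub>G\<^esub> z \<ominus>\<^bsub>H\<^esub> chi \<lbrakk>y, z\<rbrakk>\<^bsub>G\<^esub> x \<ominus>\<^bsub>H\<^esub> chi \<lbrakk>z, x\<rbrakk>\<^bsub>G\<^esub> y = \<zero>\<^bsub>H\<^esub>"
proof (rule i_eqD)
  note xyz = assms
  have JG: "\<lbrakk>\<lbrakk>x, y\<rbrakk>\<^bsub>G\<^esub>, z\<rbrakk>\<^bsub>G\<^esub> = \<zero>\<^bsub>G\<^esub> \<ominus>\<^bsub>G\<^esub> (\<lbrakk>\<lbrakk>y, z\<rbrakk>\<^bsub>G\<^esub>, x\<rbrakk>\<^bsub>G\<^esub> \<oplus>\<^bsub>G\<^esub> \<lbrakk>\<lbrakk>z, x\<rbrakk>\<^bsub>G\<^esub>, y\<rbrakk>\<^bsub>G\<^esub>)"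
    using G.jacobi[OF xyz] xyz
    by (simp add: G.bracket_antisym[of x "\<lbrakk>y, z\<rbrakk>\<^bsub>G\<^esub>"] G.bracket_antisym[of y "\<lbrakk>z, x\<rbrakk>\<^bsub>G\<^esub>"]
      G.bracket_antisym[of z "\<lbrakk>x, y\<rbrakk>\<^bsub>G\<^esub>"] G.M.additive_simps)
  have JE: "\<lbrakk>s x, \<lbrakk>s y, s z\<rbrakk>\<^bsub>E\<^esub>\<rbrakk>\<^bsub>E\<^esub>
      = \<zero>\<^bsub>E\<^esub> \<ominus>\<^bsub>E\<^esub> (\<lbrakk>s y, \<lbrakk>s z, s x\<rbrakk>\<^bsub>E\<^esub>\<rbrakk>\<^bsub>E\<^esub> \<oplus>\<^bsub>E\<^esub> \<lbrakk>s z, \<lbrakk>s x, s y\<rbrakk>\<^bsub>E\<^esub>\<rbrakk>\<^bsub>E\<^esub>)"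
    using E.jacobi[of "s x" "s y" "s z"] xyz by (simp add: E.M.additive_simps)
  show "i (psi x (chi y z) \<oplus>\<^bsub>H\<^esub> psi y (chi z x) \<oplus>\<^bsub>H\<^esub> psi z (chi x y)
    \<ominus>\<^bsub>H\<^esub> chi \<lbrakk>x, y\<rbrakk>\<^bsub>G\<^esub> z \<ominus>\<^bsub>H\<^esub> chi \<lbrakk>y, z\<rbrakk>\<^bsub>G\<^esub> x \<ominus>\<^bsub>H\<^esub> chi \<lbrakk>z, x\<rbrakk>\<^bsub>G\<^esub> y) = i \<zero>\<^bsub>H\<^esub>"
    using xyz
    by (simp add: i_simps i_triple s_simps E.bracket_simps JG JE
      E.bracket_antisym[of "s \<lbrakk>x, y\<rbrakk>\<^bsub>G\<^esub>" "s z"] E.bracket_antisym[of "s \<lbrakk>y, z\<rbrakk>\<^bsub>G\<^esub>" "s x"]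
      E.bracket_antisym[of "s \<lbrakk>z, x\<rbrakk>\<^bsub>G\<^esub>" "s y"] E.M.additive_simps)
qed (use assms in simp_all)

lemma psi_rota_baxter:
  assumes "x \<in> carrier G" "h \<in> carrier H"
  shows "psi (rbop G x) (rbop H h) = rbop H (psi x (rbop H h) \<oplus>\<^bsub>H\<^esub> psi (rbop G x) h)
    \<oplus>\<^bsub>H\<^esub> rbop H \<lbrakk>Phi x, h\<rbrakk>\<^bsub>H\<^esub> \<ominus>\<^bsub>H\<^esub> \<lbrakk>Phi x, rbop H h\<rbrakk>\<^bsub>H\<^esub>"
  by (rule i_eqD) (use assms in \<open>simp_all add: i_simps i_triple E.bracket_simps E.rbop_simps
    E.rota_baxter[of "s x" "i h"] E.M.additive_simps\<close>)

lemma chi_rota_baxter: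
  assumes "x \<in> carrier G" "y \<in> carrier G"
  shows "chi (rbop G x) (rbop G y)
      \<ominus>\<^bsub>H\<^esub> rbop H (chi x (rbop G y) \<oplus>\<^bsub>H\<^esub> chi (rbop G x) y)
      \<ominus>\<^bsub>H\<^esub> Phi (\<lbrakk>x, rbop G y\<rbrakk>\<^bsub>G\<^esub> \<oplus>\<^bsub>G\<^esub> \<lbrakk>rbop G x, y\<rbrakk>\<^bsub>G\<^esub>)
      \<oplus>\<^bsub>H\<^esub> psi (rbop G x) (Phi y) \<ominus>\<^bsub>H\<^esub> psi (rbop G y) (Phi x)
      \<ominus>\<^bsub>H\<^esub> rbop H (psi x (Phi y) \<ominus>\<^bsub>H\<^esub> psi y (Phi x))
      \<oplus>\<^bsub>H\<^esub> \<lbrakk>Phi x, Phi y\<rbrakk>\<^bsub>H\<^esub> = \<zero>\<^bsub>H\<^esub>"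
  by (rule i_eqD) (use assms in \<open>simp_all add: i_simps i_triple s_simps E.bracket_simps
    E.rbop_simps G.rbop_simps G.rota_baxter E.rota_baxter[of "s x" "s y"]
    E.bracket_antisym[of "s (rbop G y)"] E.bracket_antisym[of "s y"] E.M.additive_simps\<close>)

lemma assoc_triple_cocycle: "assoc_triple G H (E, i, p) s \<in> nab_cocycles K G H"
  unfolding assoc_triple_eq nab_cocycles_def
  using chi_alternating psi_derivation psi_linear Phi_linear
    psi_commutator chi_cocycle psi_rota_baxter chi_rota_baxter
  by auto

end

section \<open>Equivalent extensions have equivalent cocycles\<close>

text \<open>
  Triples are total functions, whose values off the carriers are arbitrary; this is equality of the
  maps that they represent.
\<close>

fun triples_agree ::
  "('k, 'g) rb_lie_alg \<Rightarrow> ('k, 'h) rb_lie_alg \<Rightarrow> ('g, 'h) nab_triple \<Rightarrow> ('g, 'h) nab_triple \<Rightarrow> bool"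
where
  "triples_agree G H (\<chi>, \<psi>, \<Phi>) (\<chi>', \<psi>', \<Phi>') \<longleftrightarrow>
     (\<forall>x\<in>carrier G. \<forall>y\<in>carrier G. \<chi> x y = \<chi>' x y) \<and>
     (\<forall>x\<in>carrier G. \<forall>h\<in>carrier H. \<psi> x h = \<psi>' x h) \<and>
     (\<forall>x\<in>carrier G. \<Phi> x = \<Phi>' x)"

lemma triples_agree_sym: "triples_agree G H c d \<Longrightarrow> triples_agree G H d c"
  by (cases c; cases d) auto

lemma triples_agree_trans:
  "triples_agree G H c d \<Longrightarrow> triples_agree G H d e \<Longrightarrow> triples_agree G H c e"
  by (cases c; cases d; cases e) auto

text \<open>
  Equivalence of cocycles with its linear map exposed: the map is the difference of two sections,
  and relations along the same map are compared in \<open>gauge_related_unique\<close>.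
\<close>

fun gauge_related ::
  "('k, 'm) ring_scheme \<Rightarrow> ('k, 'g) rb_lie_alg \<Rightarrow> ('k, 'h) rb_lie_alg \<Rightarrow> ('g \<Rightarrow> 'h)
    \<Rightarrow> ('g, 'h) nab_triple \<Rightarrow> ('g, 'h) nab_triple \<Rightarrow> bool"
where
  "gauge_related K G H \<phi> (\<chi>, \<psi>, \<Phi>) (\<chi>', \<psi>', \<Phi>') \<longleftrightarrow>
     linear_map K G H \<phi> \<and>
     (\<forall>x\<in>carrier G. \<forall>h\<in>carrier H. \<psi> x h \<ominus>\<^bsub>H\<^esub> \<psi>' x h = \<lbrakk>\<phi> x, h\<rbrakk>\<^bsub>H\<^esub>) \<and>
     (\<forall>x\<in>carrier G. \<forall>y\<in>carrier G.
        \<chi> x y \<ominus>\<^bsub>H\<^esub> \<chi>' x y =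
          \<psi>' x (\<phi> y) \<ominus>\<^bsub>H\<^esub> \<psi>' y (\<phi> x) \<ominus>\<^bsub>H\<^esub> \<phi> \<lbrakk>x, y\<rbrakk>\<^bsub>G\<^esub> \<oplus>\<^bsub>H\<^esub> \<lbrakk>\<phi> x, \<phi> y\<rbrakk>\<^bsub>H\<^esub>) \<and>
     (\<forall>x\<in>carrier G. \<Phi> x \<ominus>\<^bsub>H\<^esub> \<Phi>' x = rbop H (\<phi> x) \<ominus>\<^bsub>H\<^esub> \<phi> (rbop G x))"

lemma nab_cocycle_equiv_iff:
  "(c, c') \<in> nab_cocycle_equiv K G H \<longleftrightarrow>
     c \<in> nab_cocycles K G H \<and> c' \<in> nab_cocycles K G H \<and> (\<exists>\<phi>. gauge_related K G H \<phi> c c')"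
  by (cases c; cases c') (simp add: nab_cocycle_equiv_def)

lemma gauge_related_cong_left:
  "gauge_related K G H \<phi> c c' \<Longrightarrow> triples_agree G H c d \<Longrightarrow> gauge_related K G H \<phi> d c'"
  by (cases c; cases c'; cases d) auto

lemma gauge_related_cong_right:
  "gauge_related K G H \<phi> c c' \<Longrightarrow> triples_agree G H c' d' \<Longrightarrow> gauge_related K G H \<phi> c d'"
  by (cases c; cases c'; cases d') (auto simp: linear_map_closed)

text \<open>
  Each equation of the gauge relation subtracts an entry of the second cocycle from one of the
  first, so the second cocycle and the map determine the first cocycle on the carriers.
\<close>

lemma gauge_related_unique:
  assumes "rb_lie_algebra K H"
    and "c \<in> nab_cocycles K G H" "d \<in> nab_cocycles K G H" "c' \<in> nab_cocycles K G H"
    and "gauge_related K G H \<phi> c c'" "gauge_related K G H \<phi> d c'"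
  shows "triples_agree G H c d"
proof -
  interpret H: rb_lie_algebra K H by fact
  obtain \<chi> \<psi> \<Phi> \<chi>1 \<psi>1 \<Phi>1 \<chi>' \<psi>' \<Phi>'
    where eqs: "c = (\<chi>, \<psi>, \<Phi>)" "d = (\<chi>1, \<psi>1, \<Phi>1)" "c' = (\<chi>', \<psi>', \<Phi>')"
    by (cases c; cases d; cases c') auto
  have closed: "\<alpha> x y \<in> carrier H" "h \<in> carrier H \<Longrightarrow> \<beta> x h \<in> carrier H" "\<gamma> x \<in> carrier H"
    if "(\<alpha>, \<beta>, \<gamma>) \<in> nab_cocycles K G H" "x \<in> carrier G" "y \<in> carrier G"
    for \<alpha> \<beta> \<gamma> x y h
    using that linear_map_closed[of K G H "\<alpha> x" y] linear_map_closed[of K H H "\<beta> x" h]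
      linear_map_closed[of K G H \<gamma> x]
    by (simp_all add: nab_cocycles_def alternating_bilinear_def derivation_def)
  note closed = closed[OF assms(2)[unfolded eqs]] closed[OF assms(3)[unfolded eqs]]
    closed[OF assms(4)[unfolded eqs]]
  have cancel: "a = b"
    if "a \<ominus>\<^bsub>H\<^esub> z = r" "b \<ominus>\<^bsub>H\<^esub> z = r" "a \<in> carrier H" "b \<in> carrier H" "z \<in> carrier H"
    for a b z r
    using that by (auto simp: a_minus_def)
  have "\<chi> x y = \<chi>1 x y" if "x \<in> carrier G" "y \<in> carrier G" for x y
    by (rule cancel[of _ "\<chi>' x y"]) (use assms(5,6) that closed in \<open>auto simp: eqs\<close>)
  moreover have "\<psi> x h = \<psi>1 x h" if "x \<in> carrier G" "h \<in> carrier H" for x h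
    by (rule cancel[of _ "\<psi>' x h"]) (use assms(5,6) that closed in \<open>auto simp: eqs\<close>)
  moreover have "\<Phi> x = \<Phi>1 x" if "x \<in> carrier G" for x
    by (rule cancel[of _ "\<Phi>' x"]) (use assms(5,6) that closed in \<open>auto simp: eqs\<close>)
  ultimately show ?thesis by (simp add: eqs)
qed

context split_nab_extension
begin

text \<open>
  The section identifies \<open>E\<close> with the direct sum of \<open>G\<close> and \<open>H\<close> as a vector space. In these
  coordinates the bracket and the Rota-Baxter operator of \<open>E\<close> are given by the associated triple.
\<close>

lemma coordinates:
  assumes "u \<in> carrier E"
  obtains x h where "x \<in> carrier G" "h \<in> carrier H" "u = s x \<oplus>\<^bsub>E\<^esub> i h"
proof
  show "p u \<in> carrier G" using assms by simp
  have "p (u \<ominus>\<^bsub>E\<^esub> s (p u)) = \<zero>\<^bsub>G\<^esub>" using assms by (simp add: p_simps G.M.additive_simps)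
  then show "i_inv (u \<ominus>\<^bsub>E\<^esub> s (p u)) \<in> carrier H"
    "u = s (p u) \<oplus>\<^bsub>E\<^esub> i (i_inv (u \<ominus>\<^bsub>E\<^esub> s (p u)))"
    using assms by (simp_all add: E.M.additive_simps)
qed

lemma coordinates_p:
  "\<lbrakk>x \<in> carrier G; h \<in> carrier H\<rbrakk> \<Longrightarrow> p (s x \<oplus>\<^bsub>E\<^esub> i h) = x"
  by (simp add: p_simps)

lemma coordinates_i_inv:
  "\<lbrakk>x \<in> carrier G; h \<in> carrier H\<rbrakk> \<Longrightarrow> i_inv ((s x \<oplus>\<^bsub>E\<^esub> i h) \<ominus>\<^bsub>E\<^esub> s x) = h"
proof -
  assume xh: "x \<in> carrier G" "h \<in> carrier H"
  then have "(s x \<oplus>\<^bsub>E\<^esub> i h) \<ominus>\<^bsub>E\<^esub> s x = i h" by (simp add: E.M.additive_simps)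
  then show ?thesis using xh by simp
qed

lemma coordinates_add:
  "\<lbrakk>x \<in> carrier G; y \<in> carrier G; h \<in> carrier H; k \<in> carrier H\<rbrakk>
    \<Longrightarrow> (s x \<oplus>\<^bsub>E\<^esub> i h) \<oplus>\<^bsub>E\<^esub> (s y \<oplus>\<^bsub>E\<^esub> i k) = s (x \<oplus>\<^bsub>G\<^esub> y) \<oplus>\<^bsub>E\<^esub> i (h \<oplus>\<^bsub>H\<^esub> k)"
  by (simp add: s_simps i_simps E.M.additive_simps)

lemma coordinates_smult:
  "\<lbrakk>a \<in> carrier K; x \<in> carrier G; h \<in> carrier H\<rbrakk>
    \<Longrightarrow> a \<odot>\<^bsub>E\<^esub> (s x \<oplus>\<^bsub>E\<^esub> i h) = s (a \<odot>\<^bsub>G\<^esub> x) \<oplus>\<^bsub>E\<^esub> i (a \<odot>\<^bsub>H\<^esub> h)"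
  by (simp add: s_smult i_smult E.smult_r_distr)

lemma coordinates_bracket:
  "\<lbrakk>x \<in> carrier G; y \<in> carrier G; h \<in> carrier H; k \<in> carrier H\<rbrakk>
    \<Longrightarrow> \<lbrakk>s x \<oplus>\<^bsub>E\<^esub> i h, s y \<oplus>\<^bsub>E\<^esub> i k\<rbrakk>\<^bsub>E\<^esub>
      = s \<lbrakk>x, y\<rbrakk>\<^bsub>G\<^esub> \<oplus>\<^bsub>E\<^esub> i (psi x k \<ominus>\<^bsub>H\<^esub> psi y h \<oplus>\<^bsub>H\<^esub> \<lbrakk>h, k\<rbrakk>\<^bsub>H\<^esub> \<oplus>\<^bsub>H\<^esub> chi x y)"
  by (simp add: i_simps i_triple E.bracket_simps E.bracket_antisym[of "i h" "s y"]
    E.M.additive_simps)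

lemma coordinates_rbop:
  "\<lbrakk>x \<in> carrier G; h \<in> carrier H\<rbrakk>
    \<Longrightarrow> rbop E (s x \<oplus>\<^bsub>E\<^esub> i h) = s (rbop G x) \<oplus>\<^bsub>E\<^esub> i (rbop H h \<oplus>\<^bsub>H\<^esub> Phi x)"
  by (simp add: i_simps i_triple E.rbop_simps E.M.additive_simps)

text \<open>
  Substituting \<open>t = s + i \<phi>\<close> in the formulas for the triple of \<open>t\<close> and expanding: the terms that do
  not involve \<open>\<phi>\<close> form the triple of \<open>s\<close>, and the others are the right-hand sides of the gauge
  relation.
\<close>

lemma gauge_related_change_section:
  assumes t: "is_section K G (E, i, p) t" and \<phi>: "linear_map K G H \<phi>"
    and diff: "\<And>x. x \<in> carrier G \<Longrightarrow> t x = s x \<oplus>\<^bsub>E\<^esub> i (\<phi> x)"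
  shows "gauge_related K G H \<phi> (assoc_triple G H (E, i, p) t) (assoc_triple G H (E, i, p) s)"
proof -
  interpret T: split_nab_extension K G H E i p t
    using t by unfold_locales
  note [simp] = linear_map_closed[OF \<phi>]
  have "T.psi x h \<ominus>\<^bsub>H\<^esub> psi x h = \<lbrakk>\<phi> x, h\<rbrakk>\<^bsub>H\<^esub>" if "x \<in> carrier G" "h \<in> carrier H" for x h
    by (rule i_eqD) (use that in \<open>simp_all add: i_simps i_triple T.i_triple diff
      E.bracket_simps E.M.additive_simps\<close>)
  moreover have "T.chi x y \<ominus>\<^bsub>H\<^esub> chi x y =
      psi x (\<phi> y) \<ominus>\<^bsub>H\<^esub> psi y (\<phi> x) \<ominus>\<^bsub>H\<^esub> \<phi> \<lbrakk>x, y\<rbrakk>\<^bsub>G\<^esub> \<oplus>\<^bsub>H\<^esub> \<lbrakk>\<phi> x, \<phi> y\<rbrakk>\<^bsub>H\<^esub>"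
    if "x \<in> carrier G" "y \<in> carrier G" for x y
    by (rule i_eqD) (use that in \<open>simp_all add: i_simps i_triple T.i_triple diff
      E.bracket_simps E.bracket_antisym[of "s y" "i (\<phi> x)"] E.M.additive_simps\<close>)
  moreover have "T.Phi x \<ominus>\<^bsub>H\<^esub> Phi x = rbop H (\<phi> x) \<ominus>\<^bsub>H\<^esub> \<phi> (rbop G x)"
    if "x \<in> carrier G" for x
    by (rule i_eqD) (use that in \<open>simp_all add: i_simps i_triple T.i_triple diff
      E.rbop_simps E.M.additive_simps\<close>)
  ultimately show ?thesis
    using \<phi> by (simp add: assoc_triple_eq T.assoc_triple_eq)
qed

lemma section_shift:
  assumes \<phi>: "linear_map K G H \<phi>"
  shows "is_section K G (E, i, p) (\<lambda>x. s x \<oplus>\<^bsub>E\<^esub> i (\<phi> x))"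
  using linear_mapD[OF \<phi>]
  by (simp add: is_section.simps linear_map_def p_simps coordinates_add coordinates_smult)

lemma section_difference:
  assumes t: "is_section K G (E, i, p) t"
  obtains \<phi> where "linear_map K G H \<phi>"
    and "\<And>x. x \<in> carrier G \<Longrightarrow> t x = s x \<oplus>\<^bsub>E\<^esub> i (\<phi> x)"
proof
  interpret T: split_nab_extension K G H E i p t
    using t by unfold_locales
  let ?\<phi> = "\<lambda>x. i_inv (t x \<ominus>\<^bsub>E\<^esub> s x)"
  have p0 [simp]: "p (t x \<ominus>\<^bsub>E\<^esub> s x) = \<zero>\<^bsub>G\<^esub>" if "x \<in> carrier G" for x
    using that by (simp add: p_simps G.M.additive_simps)
  show "linear_map K G H ?\<phi>"
    unfolding linear_map_def
  proof (intro conjI ballI)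
    show "?\<phi> \<in> carrier G \<rightarrow> carrier H" by simp
    fix x assume x: "x \<in> carrier G"
    show "?\<phi> (x \<oplus>\<^bsub>G\<^esub> y) = ?\<phi> x \<oplus>\<^bsub>H\<^esub> ?\<phi> y" if "y \<in> carrier G" for y
      by (rule i_eqD) (use x that in \<open>simp_all add: i_simps\<close>,
        simp add: s_simps T.s_simps E.M.additive_simps)
    show "?\<phi> (a \<odot>\<^bsub>G\<^esub> x) = a \<odot>\<^bsub>H\<^esub> ?\<phi> x" if "a \<in> carrier K" for a
      by (rule i_eqD) (use x that in \<open>simp_all add: i_smult\<close>,
        simp add: s_smult T.s_smult E.smult_diff_distr)
  qed
  show "t x = s x \<oplus>\<^bsub>E\<^esub> i (?\<phi> x)" if "x \<in> carrier G" for x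
    using that by (simp add: E.M.additive_simps)
qed

end

text \<open>
  An equivalence of extensions carries a section to a section with the same triple. Conversely,
  extensions with sections of equal triples look the same in the coordinates of these sections.
\<close>

lemma nab_ext_equiv_transports_section:
  assumes GH: "rb_lie_algebra K G" "rb_lie_algebra K H"
    and equiv: "(X, X') \<in> nab_ext_equiv K G H" and s: "is_section K G X s"
  obtains t where "is_section K G X' t"
    and "triples_agree G H (assoc_triple G H X s) (assoc_triple G H X' t)"
proof -
  obtain E i p E' i' p' \<theta> where X: "X = (E, i, p)" "X' = (E', i', p')"
    and ext: "(E, i, p) \<in> nab_extensions K G H" "(E', i', p') \<in> nab_extensions K G H"
    and \<theta>: "rb_lie_hom K E E' \<theta>" and \<theta>_i: "\<And>h. h \<in> carrier H \<Longrightarrow> \<theta> (i h) = i' h"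
    and p_\<theta>: "\<And>u. u \<in> carrier E \<Longrightarrow> p' (\<theta> u) = p u"
    using equiv by (auto simp: nab_ext_equiv_def)
  interpret X: split_nab_extension K G H E i p s
    using ext(1) s
    by (simp add: nab_extension_iff[OF GH] split_nab_extension_def split_nab_extension_axioms_def X)
  interpret X': nab_extension K G H E' i' p'
    using ext(2) by (simp add: nab_extension_iff[OF GH])
  have \<theta>_linear: "linear_map K E E' \<theta>" using \<theta> by (simp add: rb_lie_hom_def)
  note \<theta>_closed [simp] = linear_map_closed[OF \<theta>_linear]
    and \<theta>_add = linear_map_add[OF \<theta>_linear]
    and \<theta>_smult = linear_map_smult[OF \<theta>_linear]
    and \<theta>_diff =
      linear_map_diff[OF \<theta>_linear X.E.M.abelian_group_axioms X'.E.M.abelian_group_axioms]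
  have \<theta>_bracket: "\<lbrakk>u \<in> carrier E; v \<in> carrier E\<rbrakk> \<Longrightarrow> \<lbrakk>\<theta> u, \<theta> v\<rbrakk>\<^bsub>E'\<^esub> = \<theta> \<lbrakk>u, v\<rbrakk>\<^bsub>E\<^esub>"
    and \<theta>_rbop: "u \<in> carrier E \<Longrightarrow> rbop E' (\<theta> u) = \<theta> (rbop E u)" for u v
    using \<theta> by (auto simp: rb_lie_hom_def)
  have t: "is_section K G X' (\<lambda>x. \<theta> (s x))"
    by (simp add: is_section.simps X linear_map_def X.s_simps X.s_smult \<theta>_add \<theta>_smult p_\<theta>)
  interpret T: split_nab_extension K G H E' i' p' "\<lambda>x. \<theta> (s x)"
    using t by unfold_locales (simp add: X)
  have "X.chi x y = T.chi x y" if "x \<in> carrier G" "y \<in> carrier G" for x y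
    by (rule T.i_eqD) (use that in \<open>simp_all add: T.i_triple X.i_triple \<theta>_bracket
      \<theta>_i[of "X.chi x y", symmetric] flip: \<theta>_diff\<close>)
  moreover have "X.psi x h = T.psi x h" if "x \<in> carrier G" "h \<in> carrier H" for x h
    by (rule T.i_eqD)
      (use that in \<open>simp_all add: T.i_triple X.i_triple \<theta>_bracket
      \<theta>_i[of "X.psi x h", symmetric] \<theta>_i[of h, symmetric]\<close>)
  moreover have "X.Phi x = T.Phi x" if "x \<in> carrier G" for x
    by (rule T.i_eqD) (use that in \<open>simp_all add: T.i_triple X.i_triple \<theta>_rbop
      \<theta>_i[of "X.Phi x", symmetric] flip: \<theta>_diff\<close>)
  ultimately show ?thesis
    using that[OF t] by (simp add: X X.assoc_triple_eq T.assoc_triple_eq)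
qed

lemma nab_ext_equivI_triples_agree:
  assumes GH: "rb_lie_algebra K G" "rb_lie_algebra K H"
    and ext: "X \<in> nab_extensions K G H" "X' \<in> nab_extensions K G H"
    and sec: "is_section K G X s" "is_section K G X' t"
    and agree: "triples_agree G H (assoc_triple G H X s) (assoc_triple G H X' t)"
  shows "(X, X') \<in> nab_ext_equiv K G H"
proof -
  obtain E i p E' i' p' where X: "X = (E, i, p)" "X' = (E', i', p')"
    by (cases X; cases X') auto
  interpret X: split_nab_extension K G H E i p s
    using ext(1) sec(1)
    by (simp add: nab_extension_iff[OF GH] split_nab_extension_def split_nab_extension_axioms_def X)
  interpret T: split_nab_extension K G H E' i' p' t
    using ext(2) sec(2)
    by (simp add: nab_extension_iff[OF GH] split_nab_extension_def split_nab_extension_axioms_def X)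
  have triple: "X.chi x y = T.chi x y" "h \<in> carrier H \<Longrightarrow> X.psi x h = T.psi x h"
    "X.Phi x = T.Phi x"
    if "x \<in> carrier G" "y \<in> carrier G" for x y h
    using agree that
    by (auto simp: X X.assoc_triple_eq T.assoc_triple_eq)
  define \<theta> where "\<theta> u = t (p u) \<oplus>\<^bsub>E'\<^esub> i' (X.i_inv (u \<ominus>\<^bsub>E\<^esub> s (p u)))" for u
  have \<theta>: "\<theta> (s x \<oplus>\<^bsub>E\<^esub> i h) = t x \<oplus>\<^bsub>E'\<^esub> i' h" if "x \<in> carrier G" "h \<in> carrier H" for x h
    using that by (simp add: \<theta>_def X.coordinates_p X.coordinates_i_inv)
  have "linear_map K E E' \<theta>"
    unfolding linear_map_def
  proof (intro conjI ballI Pi_I)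
    fix u assume "u \<in> carrier E"
    then obtain x h where u: "x \<in> carrier G" "h \<in> carrier H" "u = s x \<oplus>\<^bsub>E\<^esub> i h"
      by (rule X.coordinates)
    then show "\<theta> u \<in> carrier E'" by (simp add: \<theta>)
    show "\<theta> (a \<odot>\<^bsub>E\<^esub> u) = a \<odot>\<^bsub>E'\<^esub> \<theta> u" if "a \<in> carrier K" for a
      using u that by (simp add: \<theta> X.coordinates_smult T.coordinates_smult)
    fix v assume "v \<in> carrier E"
    then obtain y k where v: "y \<in> carrier G" "k \<in> carrier H" "v = s y \<oplus>\<^bsub>E\<^esub> i k"
      by (rule X.coordinates)
    show "\<theta> (u \<oplus>\<^bsub>E\<^esub> v) = \<theta> u \<oplus>\<^bsub>E'\<^esub> \<theta> v"
      using u v by (simp add: \<theta> X.coordinates_add T.coordinates_add)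
  qed
  moreover have "\<theta> \<lbrakk>u, v\<rbrakk>\<^bsub>E\<^esub> = \<lbrakk>\<theta> u, \<theta> v\<rbrakk>\<^bsub>E'\<^esub>" if uv: "u \<in> carrier E" "v \<in> carrier E" for u v
  proof -
    obtain x h where u: "x \<in> carrier G" "h \<in> carrier H" "u = s x \<oplus>\<^bsub>E\<^esub> i h"
      using uv(1) by (rule X.coordinates)
    obtain y k where v: "y \<in> carrier G" "k \<in> carrier H" "v = s y \<oplus>\<^bsub>E\<^esub> i k"
      using uv(2) by (rule X.coordinates)
    show ?thesis using u v by (simp add: \<theta> X.coordinates_bracket T.coordinates_bracket triple)
  qed
  moreover have "rbop E' (\<theta> u) = \<theta> (rbop E u)" if "u \<in> carrier E" for u
  proof -
    obtain x h where u: "x \<in> carrier G" "h \<in> carrier H" "u = s x \<oplus>\<^bsub>E\<^esub> i h"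
      using \<open>u \<in> carrier E\<close> by (rule X.coordinates)
    then show ?thesis by (simp add: \<theta> X.coordinates_rbop T.coordinates_rbop triple)
  qed
  ultimately have "rb_lie_hom K E E' \<theta>" by (auto simp: rb_lie_hom_def)
  moreover have "\<theta> (i h) = i' h" if "h \<in> carrier H" for h
    using \<theta>[of "\<zero>\<^bsub>G\<^esub>" h] that by (simp add: X.s_zero T.s_zero)
  moreover have "p' (\<theta> u) = p u" if "u \<in> carrier E" for u
  proof -
    obtain x h where "x \<in> carrier G" "h \<in> carrier H" "u = s x \<oplus>\<^bsub>E\<^esub> i h"
      using \<open>u \<in> carrier E\<close> by (rule X.coordinates)
    then show ?thesis by (simp add: \<theta> X.coordinates_p T.coordinates_p)
  qed
  ultimately show ?thesis
    using ext by (auto simp: X nab_ext_equiv_def)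
qed

section \<open>The extension of a cocycle\<close>

text \<open>
  The total space is the direct sum of \<open>G\<close> and \<open>H\<close>, relabelled by the injection \<open>f\<close>. The bracket
  and the operator are read off from the coordinate formulas of an arbitrary split extension.
\<close>

locale nab_cocycle = G: rb_lie_algebra K G + H: rb_lie_algebra K H
  for K :: "('k, 'm) ring_scheme" and G :: "('k, 'g) rb_lie_alg"
    and H :: "('k, 'h) rb_lie_alg" +
  fixes \<chi> \<psi> \<Phi> and f :: "'g \<times> 'h \<Rightarrow> 'e"
  assumes cocycle: "(\<chi>, \<psi>, \<Phi>) \<in> nab_cocycles K G H"
    and f_inj: "inj_on f (carrier G \<times> carrier H)"
begin

lemma cocycle_linear:
  shows chi_linear_right: "x \<in> carrier G \<Longrightarrow> linear_map K G H (\<chi> x)"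
    and chi_linear_left: "y \<in> carrier G \<Longrightarrow> linear_map K G H (\<lambda>x. \<chi> x y)"
    and chi_self: "x \<in> carrier G \<Longrightarrow> \<chi> x x = \<zero>\<^bsub>H\<^esub>"
    and psi_linear_right: "x \<in> carrier G \<Longrightarrow> linear_map K H H (\<psi> x)"
    and psi_linear_left: "h \<in> carrier H \<Longrightarrow> linear_map K G H (\<lambda>x. \<psi> x h)"
    and Phi_linear: "linear_map K G H \<Phi>"
  using cocycle by (simp_all add: nab_cocycles_def alternating_bilinear_def derivation_def)

lemmas cocycle_closed [simp] =
  linear_map_closed[OF chi_linear_right] linear_map_closed[OF psi_linear_right]
  linear_map_closed[OF Phi_linear]

lemmas cocycle_additive =
  linear_map_add[OF chi_linear_right] linear_map_add[OF chi_linear_left]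
  linear_map_add[OF psi_linear_right] linear_map_add[OF psi_linear_left]
  linear_map_add[OF Phi_linear]
  linear_map_diff[OF psi_linear_right H.M.abelian_group_axioms H.M.abelian_group_axioms]
  linear_map_zero[OF chi_linear_right G.M.abelian_group_axioms H.M.abelian_group_axioms]
  linear_map_zero[OF chi_linear_left G.M.abelian_group_axioms H.M.abelian_group_axioms]
  linear_map_zero[OF psi_linear_right H.M.abelian_group_axioms H.M.abelian_group_axioms]
  linear_map_zero[OF psi_linear_left G.M.abelian_group_axioms H.M.abelian_group_axioms]
  linear_map_zero[OF Phi_linear G.M.abelian_group_axioms H.M.abelian_group_axioms]

lemmas cocycle_smult =
  linear_map_smult[OF chi_linear_right] linear_map_smult[OF chi_linear_left]
  linear_map_smult[OF psi_linear_right] linear_map_smult[OF psi_linear_left]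
  linear_map_smult[OF Phi_linear]

lemma chi_antisym:
  assumes "x \<in> carrier G" "y \<in> carrier G"
  shows "\<chi> x y = \<zero>\<^bsub>H\<^esub> \<ominus>\<^bsub>H\<^esub> \<chi> y x"
proof -
  have "\<chi> (x \<oplus>\<^bsub>G\<^esub> y) (x \<oplus>\<^bsub>G\<^esub> y) = \<zero>\<^bsub>H\<^esub>" using assms by (intro chi_self) simp
  then show ?thesis
    using assms by (simp add: cocycle_additive chi_self[OF assms(1)] chi_self[OF assms(2)]
      H.M.additive_simps)
qed

lemma psi_bracket:
  "\<lbrakk>x \<in> carrier G; h \<in> carrier H; k \<in> carrier H\<rbrakk>
    \<Longrightarrow> \<psi> x \<lbrakk>h, k\<rbrakk>\<^bsub>H\<^esub> = \<lbrakk>\<psi> x h, k\<rbrakk>\<^bsub>H\<^esub> \<oplus>\<^bsub>H\<^esub> \<lbrakk>h, \<psi> x k\<rbrakk>\<^bsub>H\<^esub>"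
  using cocycle by (simp add: nab_cocycles_def derivation_def)

text \<open>The cocycle identities, each solved for one of its terms so as to serve as a rewrite rule.\<close>

lemma psi_psi:
  assumes "x \<in> carrier G" "y \<in> carrier G" "h \<in> carrier H"
  shows "\<psi> x (\<psi> y h) = \<psi> y (\<psi> x h) \<oplus>\<^bsub>H\<^esub> \<psi> \<lbrakk>x, y\<rbrakk>\<^bsub>G\<^esub> h \<oplus>\<^bsub>H\<^esub> \<lbrakk>\<chi> x y, h\<rbrakk>\<^bsub>H\<^esub>"
proof -
  have "\<psi> x (\<psi> y h) \<ominus>\<^bsub>H\<^esub> \<psi> y (\<psi> x h) \<ominus>\<^bsub>H\<^esub> \<psi> \<lbrakk>x, y\<rbrakk>\<^bsub>G\<^esub> h = \<lbrakk>\<chi> x y, h\<rbrakk>\<^bsub>H\<^esub>"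
    using cocycle assms by (simp add: nab_cocycles_def)
  then show ?thesis using assms by (simp add: H.M.additive_simps)
qed

lemma psi_chi:
  assumes "x \<in> carrier G" "y \<in> carrier G" "z \<in> carrier G"
  shows "\<psi> x (\<chi> y z) = \<chi> \<lbrakk>x, y\<rbrakk>\<^bsub>G\<^esub> z \<oplus>\<^bsub>H\<^esub> \<chi> \<lbrakk>y, z\<rbrakk>\<^bsub>G\<^esub> x \<oplus>\<^bsub>H\<^esub> \<chi> \<lbrakk>z, x\<rbrakk>\<^bsub>G\<^esub> y
    \<ominus>\<^bsub>H\<^esub> (\<psi> y (\<chi> z x) \<oplus>\<^bsub>H\<^esub> \<psi> z (\<chi> x y))"
proof -
  have "\<psi> x (\<chi> y z) \<oplus>\<^bsub>H\<^esub> \<psi> y (\<chi> z x) \<oplus>\<^bsub>H\<^esub> \<psi> z (\<chi> x y)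
    \<ominus>\<^bsub>H\<^esub> \<chi> \<lbrakk>x, y\<rbrakk>\<^bsub>G\<^esub> z \<ominus>\<^bsub>H\<^esub> \<chi> \<lbrakk>y, z\<rbrakk>\<^bsub>G\<^esub> x \<ominus>\<^bsub>H\<^esub> \<chi> \<lbrakk>z, x\<rbrakk>\<^bsub>G\<^esub> y = \<zero>\<^bsub>H\<^esub>"
    using cocycle assms by (simp add: nab_cocycles_def)
  then show ?thesis using assms by (simp add: H.M.additive_simps)
qed

lemma psi_rbop:
  assumes "x \<in> carrier G" "h \<in> carrier H"
  shows "\<psi> (rbop G x) (rbop H h) = rbop H (\<psi> x (rbop H h) \<oplus>\<^bsub>H\<^esub> \<psi> (rbop G x) h)
    \<oplus>\<^bsub>H\<^esub> rbop H \<lbrakk>\<Phi> x, h\<rbrakk>\<^bsub>H\<^esub> \<ominus>\<^bsub>H\<^esub> \<lbrakk>\<Phi> x, rbop H h\<rbrakk>\<^bsub>H\<^esub>"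
  using cocycle assms by (simp add: nab_cocycles_def)

lemma chi_rbop:
  assumes "x \<in> carrier G" "y \<in> carrier G"
  shows "\<chi> (rbop G x) (rbop G y) =
      rbop H (\<chi> x (rbop G y) \<oplus>\<^bsub>H\<^esub> \<chi> (rbop G x) y)
      \<oplus>\<^bsub>H\<^esub> \<Phi> (\<lbrakk>x, rbop G y\<rbrakk>\<^bsub>G\<^esub> \<oplus>\<^bsub>G\<^esub> \<lbrakk>rbop G x, y\<rbrakk>\<^bsub>G\<^esub>)
      \<ominus>\<^bsub>H\<^esub> \<psi> (rbop G x) (\<Phi> y) \<oplus>\<^bsub>H\<^esub> \<psi> (rbop G y) (\<Phi> x)
      \<oplus>\<^bsub>H\<^esub> rbop H (\<psi> x (\<Phi> y) \<ominus>\<^bsub>H\<^esub> \<psi> y (\<Phi> x))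
      \<ominus>\<^bsub>H\<^esub> \<lbrakk>\<Phi> x, \<Phi> y\<rbrakk>\<^bsub>H\<^esub>"
proof -
  have "\<chi> (rbop G x) (rbop G y)
      \<ominus>\<^bsub>H\<^esub> rbop H (\<chi> x (rbop G y) \<oplus>\<^bsub>H\<^esub> \<chi> (rbop G x) y)
      \<ominus>\<^bsub>H\<^esub> \<Phi> (\<lbrakk>x, rbop G y\<rbrakk>\<^bsub>G\<^esub> \<oplus>\<^bsub>G\<^esub> \<lbrakk>rbop G x, y\<rbrakk>\<^bsub>G\<^esub>)
      \<oplus>\<^bsub>H\<^esub> \<psi> (rbop G x) (\<Phi> y) \<ominus>\<^bsub>H\<^esub> \<psi> (rbop G y) (\<Phi> x)
      \<ominus>\<^bsub>H\<^esub> rbop H (\<psi> x (\<Phi> y) \<ominus>\<^bsub>H\<^esub> \<psi> y (\<Phi> x))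
      \<oplus>\<^bsub>H\<^esub> \<lbrakk>\<Phi> x, \<Phi> y\<rbrakk>\<^bsub>H\<^esub> = \<zero>\<^bsub>H\<^esub>"
    using cocycle assms by (simp add: nab_cocycles_def)
  then show ?thesis using assms by (simp add: H.M.additive_simps)
qed

definition base :: "'e \<Rightarrow> 'g" where
  "base u = fst (the_inv_into (carrier G \<times> carrier H) f u)"

definition fibre :: "'e \<Rightarrow> 'h" where
  "fibre u = snd (the_inv_into (carrier G \<times> carrier H) f u)"

definition total :: "('k, 'e) rb_lie_alg" where
  "total =
    \<lparr>carrier = f ` (carrier G \<times> carrier H), mult = (\<lambda>u v. u), one = f (\<zero>\<^bsub>G\<^esub>, \<zero>\<^bsub>H\<^esub>),
     zero = f (\<zero>\<^bsub>G\<^esub>, \<zero>\<^bsub>H\<^esub>),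
     add = (\<lambda>u v. f (base u \<oplus>\<^bsub>G\<^esub> base v, fibre u \<oplus>\<^bsub>H\<^esub> fibre v)),
     smult = (\<lambda>a u. f (a \<odot>\<^bsub>G\<^esub> base u, a \<odot>\<^bsub>H\<^esub> fibre u)),
     bracket = (\<lambda>u v. f (\<lbrakk>base u, base v\<rbrakk>\<^bsub>G\<^esub>,
       \<psi> (base u) (fibre v) \<ominus>\<^bsub>H\<^esub> \<psi> (base v) (fibre u) \<oplus>\<^bsub>H\<^esub> \<lbrakk>fibre u, fibre v\<rbrakk>\<^bsub>H\<^esub>
         \<oplus>\<^bsub>H\<^esub> \<chi> (base u) (base v))),
     rbop = (\<lambda>u. f (rbop G (base u), rbop H (fibre u) \<oplus>\<^bsub>H\<^esub> \<Phi> (base u)))\<rparr>"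

lemma
  assumes "x \<in> carrier G" "h \<in> carrier H"
  shows base_f [simp]: "base (f (x, h)) = x" and fibre_f [simp]: "fibre (f (x, h)) = h"
  using assms f_inj by (simp_all add: base_def fibre_def the_inv_into_f_f)

lemma f_eq_iff [simp]:
  "\<lbrakk>x \<in> carrier G; y \<in> carrier G; h \<in> carrier H; k \<in> carrier H\<rbrakk>
    \<Longrightarrow> f (x, h) = f (y, k) \<longleftrightarrow> x = y \<and> h = k"
  using f_inj by (auto simp: inj_on_def)

lemma f_closed [simp]: "\<lbrakk>x \<in> carrier G; h \<in> carrier H\<rbrakk> \<Longrightarrow> f (x, h) \<in> carrier total"
  by (simp add: total_def)

lemma totalE:
  assumes "u \<in> carrier total"
  obtains x h where "x \<in> carrier G" "h \<in> carrier H" "u = f (x, h)"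
  using assms by (auto simp: total_def)

lemma total_zero: "\<zero>\<^bsub>total\<^esub> = f (\<zero>\<^bsub>G\<^esub>, \<zero>\<^bsub>H\<^esub>)"
  by (simp add: total_def)

lemma total_ops:
  assumes "x \<in> carrier G" "h \<in> carrier H"
  shows total_smult: "a \<odot>\<^bsub>total\<^esub> f (x, h) = f (a \<odot>\<^bsub>G\<^esub> x, a \<odot>\<^bsub>H\<^esub> h)"
    and total_rbop: "rbop total (f (x, h)) = f (rbop G x, rbop H h \<oplus>\<^bsub>H\<^esub> \<Phi> x)"
    and total_add: "\<lbrakk>y \<in> carrier G; k \<in> carrier H\<rbrakk>
      \<Longrightarrow> f (x, h) \<oplus>\<^bsub>total\<^esub> f (y, k) = f (x \<oplus>\<^bsub>G\<^esub> y, h \<oplus>\<^bsub>H\<^esub> k)"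
    and total_bracket: "\<lbrakk>y \<in> carrier G; k \<in> carrier H\<rbrakk>
      \<Longrightarrow> \<lbrakk>f (x, h), f (y, k)\<rbrakk>\<^bsub>total\<^esub>
        = f (\<lbrakk>x, y\<rbrakk>\<^bsub>G\<^esub>, \<psi> x k \<ominus>\<^bsub>H\<^esub> \<psi> y h \<oplus>\<^bsub>H\<^esub> \<lbrakk>h, k\<rbrakk>\<^bsub>H\<^esub> \<oplus>\<^bsub>H\<^esub> \<chi> x y)"
  using assms by (simp_all add: total_def)

lemma total_abelian_group: "abelian_group total"
proof (rule abelian_groupI)
  show "\<zero>\<^bsub>total\<^esub> \<in> carrier total" by (simp add: total_zero)
  fix u assume u: "u \<in> carrier total"
  then show "\<zero>\<^bsub>total\<^esub> \<oplus>\<^bsub>total\<^esub> u = u"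
    by (auto elim!: totalE simp: total_zero total_ops)
  show "\<exists>v\<in>carrier total. v \<oplus>\<^bsub>total\<^esub> u = \<zero>\<^bsub>total\<^esub>"
  proof -
    obtain x h where xh: "x \<in> carrier G" "h \<in> carrier H" "u = f (x, h)" using u by (rule totalE)
    show ?thesis
      by (rule bexI[of _ "f (\<ominus>\<^bsub>G\<^esub> x, \<ominus>\<^bsub>H\<^esub> h)"])
        (use xh in \<open>simp_all add: total_ops total_zero G.M.l_neg H.M.l_neg\<close>)
  qed
  fix v assume v: "v \<in> carrier total"
  show "u \<oplus>\<^bsub>total\<^esub> v \<in> carrier total"
    using u v by (auto elim!: totalE simp: total_ops)
  show "u \<oplus>\<^bsub>total\<^esub> v = v \<oplus>\<^bsub>total\<^esub> u"
    using u v by (auto elim!: totalE simp: total_ops G.M.a_comm H.M.a_comm)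
  fix w assume w: "w \<in> carrier total"
  show "(u \<oplus>\<^bsub>total\<^esub> v) \<oplus>\<^bsub>total\<^esub> w = u \<oplus>\<^bsub>total\<^esub> (v \<oplus>\<^bsub>total\<^esub> w)"
    using u v w by (auto elim!: totalE simp: total_ops G.M.a_assoc H.M.a_assoc)
qed

lemma total_module: "module K total"
proof (rule moduleI)
  show "cring K" by (rule module.axioms(1)[OF G.module_axioms])
  show "abelian_group total" by (rule total_abelian_group)
qed (auto elim!: totalE simp: total_ops G.smult_l_distr H.smult_l_distr
      G.smult_r_distr H.smult_r_distr G.smult_assoc1 H.smult_assoc1)

text \<open>
  In the coordinate in \<open>G\<close> this is the Jacobi identity of \<open>G\<close>. In the coordinate in \<open>H\<close>, the terms
  in \<open>h, k, l\<close> cancel by the Jacobi identity of \<open>H\<close>, those in two of them because \<open>\<psi>\<close> acts by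
  derivations, those in one of them by \<open>psi_psi\<close>, and those in none by \<open>psi_chi\<close>.
\<close>

lemma total_jacobi:
  assumes xyz: "x \<in> carrier G" "y \<in> carrier G" "z \<in> carrier G"
    and hkl: "h \<in> carrier H" "k \<in> carrier H" "l \<in> carrier H"
    and u: "u = f (x, h)" and v: "v = f (y, k)" and w: "w = f (z, l)"
  shows "\<lbrakk>u, \<lbrakk>v, w\<rbrakk>\<^bsub>total\<^esub>\<rbrakk>\<^bsub>total\<^esub> \<oplus>\<^bsub>total\<^esub> \<lbrakk>v, \<lbrakk>w, u\<rbrakk>\<^bsub>total\<^esub>\<rbrakk>\<^bsub>total\<^esub> \<oplus>\<^bsub>total\<^esub> \<lbrakk>w, \<lbrakk>u, v\<rbrakk>\<^bsub>total\<^esub>\<rbrakk>\<^bsub>total\<^esub>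
    = \<zero>\<^bsub>total\<^esub>"
proof -
  have JH: "\<lbrakk>h, \<lbrakk>k, l\<rbrakk>\<^bsub>H\<^esub>\<rbrakk>\<^bsub>H\<^esub> = \<zero>\<^bsub>H\<^esub> \<ominus>\<^bsub>H\<^esub> (\<lbrakk>k, \<lbrakk>l, h\<rbrakk>\<^bsub>H\<^esub>\<rbrakk>\<^bsub>H\<^esub> \<oplus>\<^bsub>H\<^esub> \<lbrakk>l, \<lbrakk>h, k\<rbrakk>\<^bsub>H\<^esub>\<rbrakk>\<^bsub>H\<^esub>)"
    using H.jacobi[OF hkl] hkl by (simp add: H.M.additive_simps)
  \<comment> \<open>antisymmetry only at these arguments, where it matches summands that cancel; applied
    everywhere it would not terminate\<close>
  note orient =
    H.bracket_antisym[of h "\<psi> y l"] H.bracket_antisym[of h "\<psi> z k"]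
    H.bracket_antisym[of k "\<psi> z h"] H.bracket_antisym[of k "\<psi> x l"]
    H.bracket_antisym[of l "\<psi> x k"] H.bracket_antisym[of l "\<psi> y h"]
    H.bracket_antisym[of h "\<chi> y z"] H.bracket_antisym[of k "\<chi> z x"]
    H.bracket_antisym[of l "\<chi> x y"]
    chi_antisym[of x "\<lbrakk>y, z\<rbrakk>\<^bsub>G\<^esub>"] chi_antisym[of y "\<lbrakk>z, x\<rbrakk>\<^bsub>G\<^esub>"] chi_antisym[of z "\<lbrakk>x, y\<rbrakk>\<^bsub>G\<^esub>"]
  show ?thesis
    unfolding u v w using xyz hkl
    by (simp add: total_ops total_zero G.jacobi H.bracket_simps cocycle_additive psi_bracket
      psi_psi[of x y l] psi_psi[of y z h] psi_psi[of z x k] psi_chi[of x y z] orient JH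
      H.M.additive_simps)
qed

text \<open>
  Again the coordinate in \<open>G\<close> is the identity of \<open>G\<close>. In the coordinate in \<open>H\<close>, the terms in both
  \<open>h\<close> and \<open>k\<close> cancel by the Rota-Baxter identity of \<open>H\<close>, those in one of them by \<open>psi_rbop\<close>,
  and those in neither by \<open>chi_rbop\<close>.
\<close>

lemma total_rota_baxter:
  assumes xy: "x \<in> carrier G" "y \<in> carrier G" and hk: "h \<in> carrier H" "k \<in> carrier H"
    and u: "u = f (x, h)" and v: "v = f (y, k)"
  shows "\<lbrakk>rbop total u, rbop total v\<rbrakk>\<^bsub>total\<^esub>
    = rbop total (\<lbrakk>rbop total u, v\<rbrakk>\<^bsub>total\<^esub> \<oplus>\<^bsub>total\<^esub> \<lbrakk>u, rbop total v\<rbrakk>\<^bsub>total\<^esub>)"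
  unfolding u v using xy hk
  by (simp add: total_ops G.rota_baxter[of x y] G.rbop_simps H.rbop_simps H.bracket_simps
      cocycle_additive psi_rbop[of x k] psi_rbop[of y h] chi_rbop[of x y]
      H.rota_baxter[of h k] H.bracket_antisym[of h "\<Phi> y"]
      H.bracket_antisym[of "rbop H h" "\<Phi> y"] H.M.additive_simps)

lemma total_rb_lie_algebra: "rb_lie_algebra K total"
proof -
  have "lie_algebra_axioms K total"
  proof
    fix u v assume u: "u \<in> carrier total" and v: "v \<in> carrier total"
    obtain x h where xh: "x \<in> carrier G" "h \<in> carrier H" "u = f (x, h)" using u by (rule totalE)
    obtain y k where yk: "y \<in> carrier G" "k \<in> carrier H" "v = f (y, k)" using v by (rule totalE)
    show "\<lbrakk>u, v\<rbrakk>\<^bsub>total\<^esub> \<in> carrier total"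
      using xh yk by (simp add: total_ops)
    show "\<lbrakk>u, u\<rbrakk>\<^bsub>total\<^esub> = \<zero>\<^bsub>total\<^esub>"
      using xh by (simp add: total_ops total_zero G.bracket_self H.bracket_self chi_self
        H.M.additive_simps)
    show "\<lbrakk>a \<odot>\<^bsub>total\<^esub> u, v\<rbrakk>\<^bsub>total\<^esub> = a \<odot>\<^bsub>total\<^esub> \<lbrakk>u, v\<rbrakk>\<^bsub>total\<^esub>" if "a \<in> carrier K" for a
      using xh yk that by (simp add: total_ops G.bracket_smult_left H.bracket_smult_left
        cocycle_smult H.smult_r_distr H.smult_diff_distr)
    show "\<lbrakk>u, a \<odot>\<^bsub>total\<^esub> v\<rbrakk>\<^bsub>total\<^esub> = a \<odot>\<^bsub>total\<^esub> \<lbrakk>u, v\<rbrakk>\<^bsub>total\<^esub>" if "a \<in> carrier K" for a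
      using xh yk that by (simp add: total_ops G.bracket_smult_right H.bracket_smult_right
        cocycle_smult H.smult_r_distr H.smult_diff_distr)
    fix w assume w: "w \<in> carrier total"
    obtain z l where zl: "z \<in> carrier G" "l \<in> carrier H" "w = f (z, l)" using w by (rule totalE)
    show "\<lbrakk>u \<oplus>\<^bsub>total\<^esub> v, w\<rbrakk>\<^bsub>total\<^esub> = \<lbrakk>u, w\<rbrakk>\<^bsub>total\<^esub> \<oplus>\<^bsub>total\<^esub> \<lbrakk>v, w\<rbrakk>\<^bsub>total\<^esub>"
      "\<lbrakk>u, v \<oplus>\<^bsub>total\<^esub> w\<rbrakk>\<^bsub>total\<^esub> = \<lbrakk>u, v\<rbrakk>\<^bsub>total\<^esub> \<oplus>\<^bsub>total\<^esub> \<lbrakk>u, w\<rbrakk>\<^bsub>total\<^esub>"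
      using xh yk zl by (simp_all add: total_ops G.bracket_simps H.bracket_simps
        cocycle_additive H.M.additive_simps)
    show "\<lbrakk>u, \<lbrakk>v, w\<rbrakk>\<^bsub>total\<^esub>\<rbrakk>\<^bsub>total\<^esub> \<oplus>\<^bsub>total\<^esub> \<lbrakk>v, \<lbrakk>w, u\<rbrakk>\<^bsub>total\<^esub>\<rbrakk>\<^bsub>total\<^esub> \<oplus>\<^bsub>total\<^esub> \<lbrakk>w, \<lbrakk>u, v\<rbrakk>\<^bsub>total\<^esub>\<rbrakk>\<^bsub>total\<^esub>
      = \<zero>\<^bsub>total\<^esub>"
      by (rule total_jacobi[OF xh(1) yk(1) zl(1) xh(2) yk(2) zl(2) xh(3) yk(3) zl(3)])
  qed
  moreover have "rb_lie_algebra_axioms K total"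
  proof
    show "linear_map K total total (rbop total)"
      unfolding linear_map_def
      by (auto elim!: totalE simp: total_ops G.rbop_simps H.rbop_simps G.rbop_smult H.rbop_smult
        cocycle_additive cocycle_smult H.smult_r_distr H.M.additive_simps)
    fix u v assume u: "u \<in> carrier total" and v: "v \<in> carrier total"
    obtain x h where xh: "x \<in> carrier G" "h \<in> carrier H" "u = f (x, h)" using u by (rule totalE)
    obtain y k where yk: "y \<in> carrier G" "k \<in> carrier H" "v = f (y, k)" using v by (rule totalE)
    show "\<lbrakk>rbop total u, rbop total v\<rbrakk>\<^bsub>total\<^esub>
      = rbop total (\<lbrakk>rbop total u, v\<rbrakk>\<^bsub>total\<^esub> \<oplus>\<^bsub>total\<^esub> \<lbrakk>u, rbop total v\<rbrakk>\<^bsub>total\<^esub>)"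
      by (rule total_rota_baxter[OF xh(1) yk(1) xh(2) yk(2) xh(3) yk(3)])
  qed
  ultimately show ?thesis
    using total_module G.field_axioms
    by (simp add: rb_lie_algebra_def lie_algebra_def)
qed

lemma total_extension:
  "(total, \<lambda>h. f (\<zero>\<^bsub>G\<^esub>, h), base) \<in> nab_extensions K G H"
proof -
  have "rb_lie_hom K H total (\<lambda>h. f (\<zero>\<^bsub>G\<^esub>, h))"
    unfolding rb_lie_hom_def linear_map_def
    by (auto simp: total_ops G.rbop_zero G.bracket_zero_left cocycle_additive H.M.additive_simps)
  moreover have "rb_lie_hom K total G base"
    unfolding rb_lie_hom_def linear_map_def
    by (auto elim!: totalE simp: total_ops)
  moreover have "(\<lambda>h. f (\<zero>\<^bsub>G\<^esub>, h)) ` carrier H = a_kernel total G base"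
    by (auto elim!: totalE simp: a_kernel_def')
  moreover have "base ` carrier total = carrier G"
  proof
    show "base ` carrier total \<subseteq> carrier G" by (auto elim!: totalE)
    show "carrier G \<subseteq> base ` carrier total"
    proof
      fix x assume "x \<in> carrier G"
      then show "x \<in> base ` carrier total"
        by (intro image_eqI[of _ _ "f (x, \<zero>\<^bsub>H\<^esub>)"]) simp_all
    qed
  qed
  ultimately show ?thesis
    using total_rb_lie_algebra by (auto simp: nab_extensions_def inj_on_def)
qed

lemma total_section:
  "is_section K G (total, \<lambda>h. f (\<zero>\<^bsub>G\<^esub>, h), base) (\<lambda>x. f (x, \<zero>\<^bsub>H\<^esub>))"
  by (simp add: is_section.simps linear_map_def total_ops)

lemma total_triple:
  "triples_agree G H
     (assoc_triple G H (total, \<lambda>h. f (\<zero>\<^bsub>G\<^esub>, h), base) (\<lambda>x. f (x, \<zero>\<^bsub>H\<^esub>))) (\<chi>, \<psi>, \<Phi>)"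
proof -
  interpret S: split_nab_extension K G H total "\<lambda>h. f (\<zero>\<^bsub>G\<^esub>, h)" base "\<lambda>x. f (x, \<zero>\<^bsub>H\<^esub>)"
    using total_extension total_section G.rb_lie_algebra_axioms H.rb_lie_algebra_axioms
    by (simp add: nab_extension_iff split_nab_extension_def split_nab_extension_axioms_def)
  have "S.chi x y = \<chi> x y" if "x \<in> carrier G" "y \<in> carrier G" for x y
    by (rule S.i_eqD) (use that in \<open>simp_all add: S.i_triple total_ops cocycle_additive
      H.bracket_simps S.E.M.diff_eq_iff H.M.additive_simps\<close>)
  moreover have "S.psi x h = \<psi> x h" if "x \<in> carrier G" "h \<in> carrier H" for x h
    by (rule S.i_eqD) (use that in \<open>simp_all add: S.i_triple total_ops cocycle_additive
      G.bracket_simps H.bracket_simps H.M.additive_simps\<close>)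
  moreover have "S.Phi x = \<Phi> x" if "x \<in> carrier G" for x
    by (rule S.i_eqD) (use that in \<open>simp_all add: S.i_triple total_ops H.rbop_simps
      S.E.M.diff_eq_iff\<close>)
  ultimately show ?thesis
    by (simp add: S.assoc_triple_eq)
qed

end

section \<open>The classification\<close>

lemma nab_extension_has_section:
  assumes "rb_lie_algebra K G" "rb_lie_algebra K H" and "X \<in> nab_extensions K G H"
  obtains s where "is_section K G X s"
proof -
  obtain E i p where X: "X = (E, i, p)" by (cases X)
  interpret nab_extension K G H E i p
    using assms by (simp add: X nab_extension_iff[OF assms(1,2)])
  show thesis
    using epimorphism_splits[OF G.field_axioms E.module_axioms G.module_axioms p_linear p_surj]
      that X by (auto simp: is_section.simps)
qed

lemma assoc_triple_in_nab_cocycles: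
  assumes "rb_lie_algebra K G" "rb_lie_algebra K H"
    and "X \<in> nab_extensions K G H" "is_section K G X s"
  shows "assoc_triple G H X s \<in> nab_cocycles K G H"
proof -
  obtain E i p where X: "X = (E, i, p)" by (cases X)
  interpret split_nab_extension K G H E i p s
    using assms(3,4)
    by (simp add: X nab_extension_iff[OF assms(1,2)] split_nab_extension_def
      split_nab_extension_axioms_def)
  show ?thesis unfolding X by (rule assoc_triple_cocycle)
qed

text \<open>
  This equivalence is both the well-definedness and the injectivity of the classifying map. A gauge
  map relating the two triples is a change of section in the second extension; after that change
  the triples coincide.
\<close>

lemma nab_ext_equiv_iff_assoc_triple:
  assumes GH: "rb_lie_algebra K G" "rb_lie_algebra K H"
    and ext: "X \<in> nab_extensions K G H" "X' \<in> nab_extensions K G H"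
    and sec: "is_section K G X s" "is_section K G X' s'"
  shows "(X, X') \<in> nab_ext_equiv K G H \<longleftrightarrow>
    (assoc_triple G H X s, assoc_triple G H X' s') \<in> nab_cocycle_equiv K G H"
proof -
  obtain E' i' p' where X': "X' = (E', i', p')" by (cases X')
  interpret X': split_nab_extension K G H E' i' p' s'
    using ext(2) sec(2)
    by (simp add: X' nab_extension_iff[OF GH] split_nab_extension_def
      split_nab_extension_axioms_def)
  note cocycle = assoc_triple_in_nab_cocycles[OF GH]
  show ?thesis
  proof
    assume "(X, X') \<in> nab_ext_equiv K G H"
    then obtain t where t: "is_section K G X' t"
      and agree: "triples_agree G H (assoc_triple G H X s) (assoc_triple G H X' t)"
      using nab_ext_equiv_transports_section[OF GH] sec(1) by metis
    obtain \<phi> where "linear_map K G H \<phi>" "\<And>x. x \<in> carrier G \<Longrightarrow> t x = s' x \<oplus>\<^bsub>E'\<^esub> i' (\<phi> x)"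
      using X'.section_difference t unfolding X' by metis
    then have "gauge_related K G H \<phi> (assoc_triple G H X' t) (assoc_triple G H X' s')"
      using X'.gauge_related_change_section t unfolding X' by metis
    then have "gauge_related K G H \<phi> (assoc_triple G H X s) (assoc_triple G H X' s')"
      using gauge_related_cong_left triples_agree_sym[OF agree] by metis
    then show "(assoc_triple G H X s, assoc_triple G H X' s') \<in> nab_cocycle_equiv K G H"
      using cocycle[OF ext(1) sec(1)] cocycle[OF ext(2) sec(2)] nab_cocycle_equiv_iff by metis
  next
    assume "(assoc_triple G H X s, assoc_triple G H X' s') \<in> nab_cocycle_equiv K G H"
    then obtain \<phi> where \<phi>: "gauge_related K G H \<phi> (assoc_triple G H X s) (assoc_triple G H X' s')"
      by (auto simp: nab_cocycle_equiv_iff)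
    then have \<phi>_linear: "linear_map K G H \<phi>"
      by (cases "assoc_triple G H X s"; cases "assoc_triple G H X' s'") simp
    let ?t = "\<lambda>x. s' x \<oplus>\<^bsub>E'\<^esub> i' (\<phi> x)"
    have t: "is_section K G X' ?t"
      unfolding X' by (rule X'.section_shift[OF \<phi>_linear])
    have "gauge_related K G H \<phi> (assoc_triple G H X' ?t) (assoc_triple G H X' s')"
      unfolding X' by (rule X'.gauge_related_change_section[OF t[unfolded X'] \<phi>_linear refl])
    with \<phi> have "triples_agree G H (assoc_triple G H X s) (assoc_triple G H X' ?t)"
      using cocycle[OF ext(1) sec(1)] cocycle[OF ext(2) t] cocycle[OF ext(2) sec(2)]
      by (intro gauge_related_unique[OF GH(2)])
    then show "(X, X') \<in> nab_ext_equiv K G H"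
      by (rule nab_ext_equivI_triples_agree[OF GH ext sec(1) t])
  qed
qed

lemma equiv_nab_ext_equiv:
  assumes GH: "rb_lie_algebra K G" "rb_lie_algebra K H"
  shows "equiv (nab_extensions K G H) (nab_ext_equiv K G H)"
proof (rule equivI)
  show sub: "nab_ext_equiv K G H \<subseteq> nab_extensions K G H \<times> nab_extensions K G H"
    by (auto simp: nab_ext_equiv_def)
  have agree_refl: "triples_agree G H c c" for c by (cases c) simp
  show "refl_on (nab_extensions K G H) (nab_ext_equiv K G H)"
    using nab_ext_equivI_triples_agree[OF GH] nab_extension_has_section[OF GH] agree_refl
    by (metis refl_onI)
  show "sym (nab_ext_equiv K G H)"
  proof (rule symI)
    fix X X' assume XX': "(X, X') \<in> nab_ext_equiv K G H"
    then have ext: "X \<in> nab_extensions K G H" "X' \<in> nab_extensions K G H" using sub by auto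
    obtain s where s: "is_section K G X s" using nab_extension_has_section[OF GH ext(1)] .
    obtain t where "is_section K G X' t"
      "triples_agree G H (assoc_triple G H X s) (assoc_triple G H X' t)"
      using nab_ext_equiv_transports_section[OF GH XX' s] .
    then show "(X', X) \<in> nab_ext_equiv K G H"
      using nab_ext_equivI_triples_agree[OF GH] ext s triples_agree_sym by metis
  qed
  show "trans (nab_ext_equiv K G H)"
  proof (rule transI)
    fix X X' X'' assume XX': "(X, X') \<in> nab_ext_equiv K G H" "(X', X'') \<in> nab_ext_equiv K G H"
    then have ext: "X \<in> nab_extensions K G H" "X'' \<in> nab_extensions K G H" using sub by auto
    obtain s where s: "is_section K G X s" using nab_extension_has_section[OF GH ext(1)] .
    obtain t where t: "is_section K G X' t"
      "triples_agree G H (assoc_triple G H X s) (assoc_triple G H X' t)"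
      using nab_ext_equiv_transports_section[OF GH XX'(1) s] .
    obtain r where "is_section K G X'' r"
      "triples_agree G H (assoc_triple G H X' t) (assoc_triple G H X'' r)"
      using nab_ext_equiv_transports_section[OF GH XX'(2) t(1)] .
    then show "(X, X'') \<in> nab_ext_equiv K G H"
      using nab_ext_equivI_triples_agree[OF GH ext s] t(2) triples_agree_trans by metis
  qed
qed

lemma nab_cocycle_realised:
  fixes f :: "'g \<times> 'h \<Rightarrow> 'e" and G :: "('k, 'g) rb_lie_alg" and H :: "('k, 'h) rb_lie_alg"
  assumes GH: "rb_lie_algebra K G" "rb_lie_algebra K H"
    and f: "inj_on f (carrier G \<times> carrier H)" and c: "c \<in> nab_cocycles K G H"
  obtains X :: "('k, 'g, 'h, 'e) rb_ext" and s where "X \<in> nab_extensions K G H"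
    and "is_section K G X s" and "triples_agree G H (assoc_triple G H X s) c"
proof -
  obtain \<chi> \<psi> \<Phi> where c_eq: "c = (\<chi>, \<psi>, \<Phi>)" by (cases c)
  interpret nab_cocycle K G H \<chi> \<psi> \<Phi> f
    using GH f c by (simp add: c_eq nab_cocycle_def nab_cocycle_axioms_def)
  show thesis
    using that[OF total_extension total_section] total_triple by (simp add: c_eq)
qed

text \<open>
  Realising cocycles by extensions reduces reflexivity, symmetry and transitivity of cocycle
  equivalence to those of extension equivalence.
\<close>

lemma equiv_nab_cocycle_equiv:
  fixes K :: "('k, 'm) ring_scheme" and G :: "('k, 'g) rb_lie_alg" and H :: "('k, 'h) rb_lie_alg"
  assumes GH: "rb_lie_algebra K G" "rb_lie_algebra K H"
  shows "equiv (nab_cocycles K G H) (nab_cocycle_equiv K G H)"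
proof -
  let ?Z = "nab_cocycles K G H"
  let ?A = "nab_extensions K G H :: ('k, 'g, 'h, 'g \<times> 'h) rb_ext set"
  have "\<exists>X s. X \<in> ?A \<and> is_section K G X s \<and> triples_agree G H (assoc_triple G H X s) c"
    if c: "c \<in> ?Z" for c
    by (rule nab_cocycle_realised[OF GH inj_on_id c]) auto
  then obtain X s where Xs: "\<And>c. c \<in> ?Z \<Longrightarrow> X c \<in> ?A \<and> is_section K G (X c) (s c) \<and>
      triples_agree G H (assoc_triple G H (X c) (s c)) c"
    by metis
  have iff: "(c, d) \<in> nab_cocycle_equiv K G H \<longleftrightarrow> (X c, X d) \<in> nab_ext_equiv K G H"
    if c: "c \<in> ?Z" and d: "d \<in> ?Z" for c d
  proof -
    let ?c = "assoc_triple G H (X c) (s c)" and ?d = "assoc_triple G H (X d) (s d)"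
    have agree: "triples_agree G H ?c c" "triples_agree G H ?d d" using Xs c d by auto
    have Z: "?c \<in> ?Z" "?d \<in> ?Z" using Xs[OF c] Xs[OF d]
      by (auto intro: assoc_triple_in_nab_cocycles[OF GH])
    have "gauge_related K G H \<phi> c d \<longleftrightarrow> gauge_related K G H \<phi> ?c ?d" for \<phi>
    proof
      assume "gauge_related K G H \<phi> c d"
      from gauge_related_cong_left[OF this triples_agree_sym[OF agree(1)]]
      show "gauge_related K G H \<phi> ?c ?d"
        by (rule gauge_related_cong_right[OF _ triples_agree_sym[OF agree(2)]])
    next
      assume "gauge_related K G H \<phi> ?c ?d"
      from gauge_related_cong_left[OF this agree(1)]
      show "gauge_related K G H \<phi> c d"
        by (rule gauge_related_cong_right[OF _ agree(2)])
    qed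
    then have "(c, d) \<in> nab_cocycle_equiv K G H \<longleftrightarrow> (?c, ?d) \<in> nab_cocycle_equiv K G H"
      using c d Z by (simp add: nab_cocycle_equiv_iff)
    also have "\<dots> \<longleftrightarrow> (X c, X d) \<in> nab_ext_equiv K G H"
      using nab_ext_equiv_iff_assoc_triple[OF GH] Xs c d by blast
    finally show ?thesis .
  qed
  have sub: "nab_cocycle_equiv K G H \<subseteq> ?Z \<times> ?Z" by (auto simp: nab_cocycle_equiv_def)
  have ext: "refl_on ?A (nab_ext_equiv K G H)"
    "sym (nab_ext_equiv K G H :: ('k, 'g, 'h, 'g \<times> 'h) rb_ext rel)"
    "trans (nab_ext_equiv K G H :: ('k, 'g, 'h, 'g \<times> 'h) rb_ext rel)"
    using equiv_nab_ext_equiv[OF GH] by (auto elim: equivE)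
  show ?thesis
  proof (rule equivI[OF sub])
    show "refl_on ?Z (nab_cocycle_equiv K G H)"
      using ext(1) Xs by (intro refl_onI) (simp add: iff refl_onD)
    show "sym (nab_cocycle_equiv K G H)"
    proof (rule symI)
      fix c d assume cd: "(c, d) \<in> nab_cocycle_equiv K G H"
      then have Z: "c \<in> ?Z" "d \<in> ?Z" using sub by auto
      have "(X c, X d) \<in> nab_ext_equiv K G H" using cd iff[OF Z] by simp
      then have "(X d, X c) \<in> nab_ext_equiv K G H" by (rule symD[OF ext(2)])
      then show "(d, c) \<in> nab_cocycle_equiv K G H" using iff[OF Z(2,1)] by simp
    qed
    show "trans (nab_cocycle_equiv K G H)"
    proof (rule transI)
      fix c d e assume cde: "(c, d) \<in> nab_cocycle_equiv K G H" "(d, e) \<in> nab_cocycle_equiv K G H"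
      then have Z: "c \<in> ?Z" "d \<in> ?Z" "e \<in> ?Z" using sub by auto
      have "(X c, X d) \<in> nab_ext_equiv K G H" "(X d, X e) \<in> nab_ext_equiv K G H"
        using cde iff[OF Z(1,2)] iff[OF Z(2,3)] by simp_all
      then have "(X c, X e) \<in> nab_ext_equiv K G H" by (rule transD[OF ext(3)])
      then show "(c, e) \<in> nab_cocycle_equiv K G H" using iff[OF Z(1,3)] by simp
    qed
  qed
qed

theorem theorem3p6:
  fixes K :: "('k, 'm) ring_scheme"
    and G :: "('k, 'g) rb_lie_alg"
    and H :: "('k, 'h) rb_lie_alg"
  assumes "field K" and "char_zero K"
    and "rb_lie_algebra K G" and "rb_lie_algebra K H"
    and universe: "\<exists>f :: 'g \<times> 'h \<Rightarrow> 'e. inj_on f (carrier G \<times> carrier H)"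
  shows "(\<forall>X \<in> (nab_extensions K G H :: ('k, 'g, 'h, 'e) rb_ext set).
            \<forall>s. is_section K G X s \<longrightarrow>
              Upsilon K G H (nab_ext_equiv K G H `` {X}) =
                nab_cocycle_equiv K G H `` {assoc_triple G H X s})
       \<and> bij_betw (Upsilon K G H)
           (Ext_nab K G H :: ('k, 'g, 'h, 'e) rb_ext set set)
           (H2_nab K G H)"
proof -
  note GH = assms(3,4)
  let ?A = "nab_extensions K G H :: ('k, 'g, 'h, 'e) rb_ext set"
  let ?R = "nab_ext_equiv K G H :: ('k, 'g, 'h, 'e) rb_ext rel"
  let ?Z = "nab_cocycles K G H" and ?Q = "nab_cocycle_equiv K G H"
  let ?c = "assoc_triple G H"
  have R: "equiv ?A ?R" and Q: "equiv ?Z ?Q"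
    using equiv_nab_ext_equiv[OF GH] equiv_nab_cocycle_equiv[OF GH] by auto
  have class_eq: "?Q `` {?c X s} = ?Q `` {?c X' s'} \<longleftrightarrow> (X, X') \<in> ?R"
    if "X \<in> ?A" "X' \<in> ?A" "is_section K G X s" "is_section K G X' s'" for X X' s s'
    using nab_ext_equiv_iff_assoc_triple[OF GH that]
      eq_equiv_class_iff[OF Q assoc_triple_in_nab_cocycles[OF GH that(1,3)]
        assoc_triple_in_nab_cocycles[OF GH that(2,4)]]
    by blast
  have Ups: "Upsilon K G H (?R `` {X}) = ?Q `` {?c X s}"
    if X: "X \<in> ?A" and s: "is_section K G X s" for X s
    unfolding Upsilon_def
  proof (rule the_equality)
    show "\<exists>X'\<in>?R `` {X}. \<exists>s'. is_section K G X' s' \<and> ?Q `` {?c X s} = ?Q `` {?c X' s'}"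
      using s equiv_class_self[OF R X] by blast
    fix C assume "\<exists>X'\<in>?R `` {X}. \<exists>s'. is_section K G X' s' \<and> C = ?Q `` {?c X' s'}"
    then obtain X' s' where X': "(X, X') \<in> ?R" "is_section K G X' s'" "C = ?Q `` {?c X' s'}"
      by auto
    moreover have "X' \<in> ?A" using X'(1) R by (auto simp: equiv_def)
    ultimately show "C = ?Q `` {?c X s}" using class_eq X s by metis
  qed
  have sec: "\<exists>s. is_section K G X s" if "X \<in> ?A" for X
    using nab_extension_has_section[OF GH that] by metis
  have "bij_betw (Upsilon K G H) (?A // ?R) (?Z // ?Q)"
    unfolding bij_betw_def
  proof
    show "inj_on (Upsilon K G H) (?A // ?R)"
    proof (rule inj_onI)
      fix C D assume "C \<in> ?A // ?R" "D \<in> ?A // ?R" and eq: "Upsilon K G H C = Upsilon K G H D"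
      then obtain X Y where X: "X \<in> ?A" "C = ?R `` {X}" and Y: "Y \<in> ?A" "D = ?R `` {Y}"
        by (auto elim!: quotientE)
      obtain s t where s: "is_section K G X s" and t: "is_section K G Y t"
        using sec X Y by metis
      have "(X, Y) \<in> ?R" using eq X Y s t by (simp add: Ups class_eq)
      then show "C = D" using equiv_class_eq[OF R] X Y by simp
    qed
    show "Upsilon K G H ` (?A // ?R) = ?Z // ?Q"
    proof (intro equalityI subsetI)
      fix C assume "C \<in> Upsilon K G H ` (?A // ?R)"
      then obtain X where X: "X \<in> ?A" "C = Upsilon K G H (?R `` {X})"
        by (auto elim!: quotientE)
      obtain s where s: "is_section K G X s" using sec X by metis
      show "C \<in> ?Z // ?Q"
        using X s by (simp add: Ups quotientI assoc_triple_in_nab_cocycles[OF GH])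
    next
      fix C assume "C \<in> ?Z // ?Q"
      then obtain c where c: "c \<in> ?Z" "C = ?Q `` {c}" by (auto elim!: quotientE)
      obtain f :: "'g \<times> 'h \<Rightarrow> 'e" where f: "inj_on f (carrier G \<times> carrier H)"
        using universe by auto
      obtain X :: "('k, 'g, 'h, 'e) rb_ext" and s
        where X: "X \<in> ?A" and s: "is_section K G X s" and agree: "triples_agree G H (?c X s) c"
        using nab_cocycle_realised[OF GH f c(1)] .
      have cs: "?c X s \<in> ?Z" using X s by (simp add: assoc_triple_in_nab_cocycles[OF GH])
      \<comment> \<open>equal on the carriers, the two triples are equivalent by reflexivity\<close>
      have "(c, c) \<in> ?Q" using Q c(1) by (auto simp: equiv_def refl_on_def)
      then have "(?c X s, c) \<in> ?Q"
        using cs c(1) gauge_related_cong_left triples_agree_sym[OF agree]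
        unfolding nab_cocycle_equiv_iff by metis
      then have "C = Upsilon K G H (?R `` {X})"
        using equiv_class_eq[OF Q] Ups[OF X s] c(2) by simp
      then show "C \<in> Upsilon K G H ` (?A // ?R)" using X by (simp add: quotientI)
    qed
  qed
  then show ?thesis using Ups by (simp add: Ext_nab_def H2_nab_def)
qed

end
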